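(* Let $f\in\mathbb{R}[x]$, and let $h=(h_1,\ldots,h_{m_1})$ and $g=(g_1,\ldots,g_{m_2})$ be tuples of polynomials in $\mathbb{R}[x]$, $x=(x_1,\ldots,x_n)$. Let $f_{min}$ be the optimal value of $$\min\ f(x)\quad \text{s.t.}\quad h_i(x)=0\ (i=1,\ldots,m_1),\quad g_j(x)\ge 0\ (j=1,\ldots,m_2),\quad x\in\mathbb{R}^n,$$ and for $k\in\mathbb{N}$ let $f_k$ be the optimal value of $$\max\ \gamma\quad\text{s.t.}\quad f-\gamma\in\langle h\rangle_{2k}+Q_k(g).$$ If the real variety $V_{\mathbb{R}}(h)=\{x\in\mathbb{R}^n: h(x)=0\}$ is finite, then $f_k=f_{min}$ for all $k$ big enough.
   Context: $\mathbb{R}[x]$ is the ring of real polynomials in $x=(x_1,\ldots,x_n)$, and $\mathbb{N}$ is the set of nonnegative integers. $\Sigma\mathbb{R}[x]^2$ denotes the set of sums of squares (SOS) of polynomials in $\mathbb{R}[x]$. The $2k$-th truncated ideal generated by $h$ is $$\langle h\rangle_{2k}=\Big\{\sum_{i=1}^{m_1}\phi_i h_i:\ \phi_i\in\mathbb{R}[x],\ \deg(\phi_i h_i)\le 2k\text{ for each } i\Big\}.$$ With $g_0=1$, the $k$-th truncated quadratic module generated by $g$ is $$Q_k(g)=\Big\{\sum_{j=0}^{m_2}\sigma_j g_j:\ \sigma_j\in\Sigma\mathbb{R}[x]^2,\ \deg(\sigma_j g_j)\le 2k\text{ for each } j\Big\}.$$ Optimal values are understood as an infimum (for $f_{min}$)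 and a supremum (for $f_k$) in $\mathbb{R}\cup\{\pm\infty\}$; they need not be attained. $f_{min}=+\infty$ if the feasible set is empty, and $f_k=-\infty$ if no $\gamma$ is feasible. *)

theory Defs
  imports "HOL-Analysis.Analysis" "HOL-Library.Poly_Mapping"
begin

text \<open>
  The ring \<open>\<real>[x]\<close> in variables indexed by a finite type \<open>'n\<close>: a finitely supported map from
  exponent vectors to coefficients. The ring structure is the one of \<^theory>\<open>HOL-Library.Poly_Mapping\<close>,
  whose product is the convolution product, i.e. the multiplication of polynomials.
\<close>
type_synonym 'n rpoly = "(('n, nat) poly_mapping, real) poly_mapping"

definition const_poly :: "real \<Rightarrow> 'n rpoly" where
  "const_poly c = Poly_Mapping.single 0 c"

definition eval_poly :: "'n::finite rpoly \<Rightarrow> real ^ 'n \<Rightarrow> real" where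
  "eval_poly p x =
     (\<Sum>m\<in>Poly_Mapping.keys p. Poly_Mapping.lookup p m * (\<Prod>i\<in>UNIV. (x $ i) ^ Poly_Mapping.lookup m i))"

text \<open>
  The total degree. The zero polynomial gets degree 0; as degrees are only compared with upper bounds
  \<open>2 * k\<close>, this agrees with the convention \<open>- \<infinity>\<close>.
\<close>
definition total_degree :: "'n::finite rpoly \<Rightarrow> nat" where
  "total_degree p =
     Max (insert 0 ((\<lambda>m. \<Sum>i\<in>UNIV. Poly_Mapping.lookup m i) ` Poly_Mapping.keys p))"

definition sos :: "'n rpoly set" where
  "sos = {p. \<exists>(q :: nat \<Rightarrow> 'n rpoly) r. p = (\<Sum>i<r. (q i)\<^sup>2)}"

text \<open>
  Tuples of polynomials are lists, indexed from 0. The bound \<open>d\<close> is the truncation degree,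
  so that \<open>\<langle>h\<rangle>\<^sub>2\<^sub>k\<close> is \<open>truncated_ideal h (2 * k)\<close>.
\<close>
definition truncated_ideal :: "'n::finite rpoly list \<Rightarrow> nat \<Rightarrow> 'n rpoly set" where
  "truncated_ideal h d =
     {(\<Sum>i<length h. \<phi> i * h ! i) | \<phi>.
        \<forall>i<length h. total_degree (\<phi> i * h ! i) \<le> d}"

text \<open>
  The list \<open>1 # g\<close> is \<open>(g\<^sub>0, \<dots>, g\<^sub>m)\<close> with \<open>g\<^sub>0 = 1\<close>.
\<close>
definition truncated_qmodule :: "'n::finite rpoly list \<Rightarrow> nat \<Rightarrow> 'n rpoly set" where
  "truncated_qmodule g k =
     {(\<Sum>j\<le>length g. \<sigma> j * (1 # g) ! j) | \<sigma>.
        \<forall>j\<le>length g. \<sigma> j \<in> sos \<and> total_degree (\<sigma> j * (1 # g) ! j) \<le> 2 * k}"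

definition real_variety :: "'n::finite rpoly list \<Rightarrow> (real ^ 'n) set" where
  "real_variety h = {x. \<forall>i<length h. eval_poly (h ! i) x = 0}"

definition feasible_set :: "'n::finite rpoly list \<Rightarrow> 'n rpoly list \<Rightarrow> (real ^ 'n) set" where
  "feasible_set h g =
     {x. (\<forall>i<length h. eval_poly (h ! i) x = 0) \<and> (\<forall>j<length g. eval_poly (g ! j) x \<ge> 0)}"

definition f_min :: "'n::finite rpoly \<Rightarrow> 'n rpoly list \<Rightarrow> 'n rpoly list \<Rightarrow> ereal" where
  "f_min f h g = (INF x\<in>feasible_set h g. ereal (eval_poly f x))"

definition f_relax :: "'n::finite rpoly \<Rightarrow> 'n rpoly list \<Rightarrow> 'n rpoly list \<Rightarrow> nat \<Rightarrow> ereal" where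
  "f_relax f h g k =
     (SUP \<gamma>\<in>{\<gamma>. \<exists>p\<in>truncated_ideal h (2 * k). \<exists>q\<in>truncated_qmodule g k. f - const_poly \<gamma> = p + q}. ereal \<gamma>)"

end

theory Submission
  imports Defs "HOL-Algebra.Algebraic_Closure_Type"
begin

text \<open>
  Every feasible \<open>\<gamma>\<close> of a relaxation is a lower bound of \<open>f\<close> on the feasible set, so the point is to
  find one degree \<open>k\<close> at which \<open>f - f\<^sub>m\<^sub>i\<^sub>n + \<epsilon>\<close> has a certificate for \<^emph>\<open>every\<close> \<open>\<epsilon> > 0\<close>. In general
  \<open>f - f\<^sub>m\<^sub>i\<^sub>n\<close> itself has no certificate: the supremum \<open>f\<^sub>k\<close> need not be attained.

  Since the real variety \<open>V\<close> of \<open>h\<close> is finite, interpolation yields an element \<open>q\<close> of the quadratic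
  module that takes the same values as \<open>f - f\<^sub>m\<^sub>i\<^sub>n\<close> on \<open>V\<close>: at a feasible point the value is nonnegative
  and a multiple of the square of the interpolation polynomial has it, and at an infeasible
  point some \<open>g\<^sub>j\<close> is negative, so a nonnegative multiple of \<open>g\<^sub>j\<close> times that square supplies a negative value.
  Then \<open>p = f - f\<^sub>m\<^sub>i\<^sub>n - q\<close> vanishes on \<open>V\<close>, and by the real Nullstellensatz
  (\<open>real_nullstellensatz\<close>) \<open>p\<^sup>2\<^sup>l + s\<close> lies in the ideal of \<open>h\<close> for some sum of squares \<open>s\<close>. Hence
  \<open>- p\<close> raised to a power of two, taken with a minus sign, has a certificate. Completing the square,
  \<open>\<epsilon> - c u = (\<alpha> - \<beta> u)\<^sup>2 + (\<epsilon> / 2 - \<beta>\<^sup>2 u\<^sup>2)\<close>, and iterating with \<open>u = - p, p\<^sup>2, p\<^sup>4, \<dots>\<close> leads from this power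
  down to \<open>p + \<epsilon>\<close>. The number \<open>\<epsilon>\<close> enters only through the real coefficients \<open>\<alpha>\<close>, \<open>\<beta>\<close>, so the degree
  of the certificate does not depend on it (\<open>perturbation_in_truncated_cone\<close>).
  If the feasible set is empty, the same argument certifies \<open>- 1\<close>, and then all \<open>f - \<gamma>\<close> in one degree.

  The bulk of the text proves the real Nullstellensatz. If no \<open>p\<^sup>2\<^sup>l + s\<close> is in the ideal, Zorn's lemma
  extends sums of squares plus the ideal to a prime cone, i.e. an ordering of a residue domain of
  \<open>\<real>[x]\<close>, in which \<open>h\<close> is zero and \<open>p\<close> is not (\<open>ring_preordering_extends_to_cone\<close>). The residue domain
  embeds in its ordered field of fractions and in a real closure of that field (type \<open>real_closure\<close>), so the
  classes of the variables form a point over a real closed field at which \<open>h\<close> vanishes and \<open>p\<close> does not.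
  Finally such signs are transferred to a point of \<open>\<real>\<^sup>n\<close> (\<open>hom_sign_transfer\<close>), which contradicts the
  assumption on \<open>p\<close>. The transfer eliminates one variable at a time by the method of Cohen and
  Hoermander: for a finite family of univariate polynomials that is closed under derivatives and
  remainders, the arrangement of roots and signs on the line is determined by the signs of the leading
  coefficients, over any real closed field (\<open>exists_matched_point\<close>).
\<close>

hide_const (open) Polynomials.degree Polynomials.lead_coeff Module.smult up_ring.coeff up_ring.monom Coset.order
no_notation fps_nth (infixl \<open>$\<close> 75)

section \<open>Polynomials over real closed fields\<close>

text \<open>
  Of the equivalent descriptions of real closed fields, the intermediate value property of polynomials is
  the one that sign diagrams use directly. A polynomial is spelled out as a coefficient sequence because
  the class variable has no type of polynomials within the class declaration.
\<close>
class real_closed_field = linordered_field +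
  assumes intermediate_value:
    "\<And>(f :: nat \<Rightarrow> 'a) n a b. a < b \<Longrightarrow> (\<Sum>k\<le>n. f k * a ^ k) < 0 \<Longrightarrow> 0 < (\<Sum>k\<le>n. f k * b ^ k) \<Longrightarrow>
       \<exists>c. a < c \<and> c < b \<and> (\<Sum>k\<le>n. f k * c ^ k) = 0"

instance real :: real_closed_field
proof
  fix f :: "nat \<Rightarrow> real" and n a b
  assume ab: "a < b" and neg: "(\<Sum>k\<le>n. f k * a ^ k) < 0" and pos: "0 < (\<Sum>k\<le>n. f k * b ^ k)"
  have "\<forall>x. a \<le> x \<and> x \<le> b \<longrightarrow> isCont (\<lambda>x. \<Sum>k\<le>n. f k * x ^ k) x"
    by (auto intro!: continuous_intros)
  then obtain c where c: "a \<le> c" "c \<le> b" "(\<Sum>k\<le>n. f k * c ^ k) = 0"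
    using IVT[of "\<lambda>x. \<Sum>k\<le>n. f k * x ^ k" a 0 b] ab neg pos by auto
  moreover have "c \<noteq> a" "c \<noteq> b" using c neg pos by auto
  ultimately show "\<exists>c. a < c \<and> c < b \<and> (\<Sum>k\<le>n. f k * c ^ k) = 0"
    by (intro exI[of _ c]) auto
qed

lemma poly_sign_change_root:
  fixes p :: "'a::real_closed_field poly"
  assumes "a < b" and "poly p a * poly p b < 0"
  obtains c where "a < c" "c < b" "poly p c = 0"
proof -
  have "\<exists>c. a < c \<and> c < b \<and> poly p c = 0" if "poly p a < 0" "0 < poly p b" for p :: "'a poly"
    using intermediate_value[of a b "coeff p" "degree p"] that \<open>a < b\<close> by (simp add: poly_altdef)
  from this[of p] this[of "-p"] assms that show ?thesis
    by (auto simp: mult_less_0_iff)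
qed

text \<open>
  Without completeness there is no maximum to take. Instead split off the roots,
  \<open>p = (x - a)\<^sup>m\<^sup>+\<^sup>1 (x - b)\<^sup>n\<^sup>+\<^sup>1 q\<close>; here \<open>q\<close> has no root in \<open>[a, b]\<close> and hence constant sign, and the cofactor
  \<open>s\<close> of \<open>(x - a)\<^sup>m (x - b)\<^sup>n\<close> in \<open>p'\<close> has opposite signs at \<open>a\<close> and \<open>b\<close>.
\<close>
lemma rolle_consecutive_roots:
  fixes p :: "'a::real_closed_field poly"
  assumes ab: "a < b" and pa: "poly p a = 0" and pb: "poly p b = 0" and "p \<noteq> 0"
    and noroot: "\<And>x. a < x \<Longrightarrow> x < b \<Longrightarrow> poly p x \<noteq> 0"
  obtains c where "a < c" "c < b" "poly (pderiv p) c = 0"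
proof -
  obtain q1 where q1: "p = [:- a, 1:] ^ order a p * q1" "\<not> [:- a, 1:] dvd q1"
    using order_decomp[OF \<open>p \<noteq> 0\<close>] by blast
  obtain m where m: "order a p = Suc m"
    using pa \<open>p \<noteq> 0\<close> by (metis order_root not0_implies_Suc)
  have "q1 \<noteq> 0" using q1 \<open>p \<noteq> 0\<close> by auto
  have q1a: "poly q1 a \<noteq> 0" using q1(2) by (simp add: poly_eq_0_iff_dvd)
  have q1b: "poly q1 b = 0"
    using pb ab q1(1) by (metis (no_types, lifting) add.right_neutral add_uminus_conv_diff eq_iff_diff_eq_0 mult_eq_0_iff mult_1_right mult_zero_right order_less_irrefl poly_0 poly_mult poly_pCons poly_power power_not_zero add.commute)
  obtain q where q: "q1 = [:- b, 1:] ^ order b q1 * q" "\<not> [:- b, 1:] dvd q"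
    using order_decomp[OF \<open>q1 \<noteq> 0\<close>] by blast
  obtain n where n: "order b q1 = Suc n"
    using q1b \<open>q1 \<noteq> 0\<close> by (metis order_root not0_implies_Suc)
  have qb: "poly q b \<noteq> 0" using q(2) by (simp add: poly_eq_0_iff_dvd)
  have qa: "poly q a \<noteq> 0" using q1a q(1) by (metis mult_zero_right poly_mult)
  have p_eq: "p = [:- a, 1:] ^ Suc m * ([:- b, 1:] ^ Suc n * q)"
    using q1(1) q(1) m n by simp
  have "poly q a * poly q b > 0"
  proof (rule ccontr)
    assume "\<not> poly q a * poly q b > 0"
    then have "poly q a * poly q b < 0" using qa qb by (simp add: not_less order_less_le)
    then obtain c where "a < c" "c < b" "poly q c = 0" using poly_sign_change_root ab by blast
    then show False using noroot[of c] p_eq by simp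
  qed
  \<comment> \<open>\<open>p'\<close> is this polynomial times \<open>(x - a)\<^sup>m (x - b)\<^sup>n\<close>\<close>
  define s where "s = q * ([:of_nat (Suc m):] * [:- b, 1:] + [:of_nat (Suc n):] * [:- a, 1:])
     + [:- a, 1:] * [:- b, 1:] * pderiv q"
  have "pderiv p = [:- a, 1:] ^ m * [:- b, 1:] ^ n * s"
  proof -
    obtain u v where uv: "u = [:- a, 1:]" "v = [:- b, 1:]" and "pderiv u = 1" "pderiv v = 1"
      by (simp add: pderiv_pCons one_pCons)
    then have d: "pderiv (u ^ Suc k) = smult (of_nat (Suc k)) (u ^ k)"
      "pderiv (v ^ Suc k) = smult (of_nat (Suc k)) (v ^ k)" for k
      by (simp_all only: pderiv_power_Suc mult_1_right)
    show ?thesis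
      unfolding p_eq s_def uv[symmetric] pderiv_mult d by (simp add: algebra_simps del: of_nat_Suc)
  qed
  moreover have "poly s a * poly s b < 0"
  proof -
    have "poly s a * poly s b = - ((b - a) ^ 2 * of_nat (Suc m) * of_nat (Suc n) * (poly q a * poly q b))"
      by (simp add: s_def algebra_simps power2_eq_square)
    moreover have "(b - a) ^ 2 * of_nat (Suc m) * of_nat (Suc n) * (poly q a * poly q b) > 0"
      using ab by (intro mult_pos_pos[OF _ \<open>poly q a * poly q b > 0\<close>] mult_pos_pos) (auto simp del: of_nat_Suc)
    ultimately show ?thesis by simp
  qed
  ultimately show ?thesis using poly_sign_change_root[OF ab, of s] that by auto
qed

lemma rolle_poly:
  fixes p :: "'a::real_closed_field poly"
  assumes ab: "a < b" and pa: "poly p a = 0" and pb: "poly p b = 0"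
  obtains c where "a < c" "c < b" "poly (pderiv p) c = 0"
proof (cases "p = 0")
  case True
  then show ?thesis using that dense[OF ab] by auto
next
  case False
  define R where "R = {x. poly p x = 0 \<and> a < x \<and> x \<le> b}"
  have R: "finite R" "b \<in> R"
    using poly_roots_finite[OF False] ab pb by (auto simp: R_def intro: finite_subset[rotated])
  define d where "d = Min R"
  have d: "d \<in> R" using R unfolding d_def by (intro Min_in) auto
  have "poly p x \<noteq> 0" if "a < x" "x < d" for x
  proof
    assume "poly p x = 0"
    then have "x \<in> R" using that d by (auto simp: R_def)
    then have "d \<le> x" unfolding d_def using R(1) by (intro Min_le)
    with that show False by simp
  qed
  then obtain c where "a < c" "c < d" "poly (pderiv p) c = 0"
    using rolle_consecutive_roots[of a d p] d pa False by (auto simp: R_def)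
  then show ?thesis using that d by (auto simp: R_def)
qed

lemma pderiv_pos_strict_mono:
  fixes p :: "'a::real_closed_field poly"
  assumes pos: "\<And>x. a < x \<Longrightarrow> x < b \<Longrightarrow> 0 < poly (pderiv p) x"
    and "a \<le> x" "x < y" "y \<le> b"
  shows "poly p x < poly p y"
proof -
  define k where "k = (poly p y - poly p x) / (y - x)"
  define q where "q = p - [:poly p x - k * x, k:]"
  have "poly q x = 0" "poly q y = 0"
    using \<open>x < y\<close> by (simp_all add: q_def k_def divide_simps) (simp add: algebra_simps)
  then obtain c where c: "x < c" "c < y" "poly (pderiv q) c = 0"
    using rolle_poly[OF \<open>x < y\<close>] by blast
  then have "k = poly (pderiv p) c" by (simp add: q_def pderiv_diff pderiv_pCons)
  also have "\<dots> > 0" using pos c assms by auto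
  finally show ?thesis using \<open>x < y\<close> by (simp add: k_def zero_less_divide_iff)
qed

text \<open>
  The lower bound \<open>\<delta>\<close> makes the induction on the coefficients work: multiplying a polynomial that is
  bounded away from zero by \<open>x\<close> eventually outweighs any new constant term.
\<close>
lemma eventually_sign_lead_coeff:
  fixes p :: "'a::linordered_field poly"
  shows "\<exists>M > 0. \<exists>\<delta> > 0. \<forall>x \<ge> M. p \<noteq> 0 \<longrightarrow> sgn (lead_coeff p) * poly p x \<ge> \<delta>"
proof (induction p)
  case 0
  then show ?case by (auto intro: exI[of _ 1])
next
  case (pCons a p)
  show ?case
  proof (cases "p = 0")
    case True
    then have "a \<noteq> 0" using pCons by auto
    then show ?thesis using True
      by (intro exI[of _ 1] conjI exI[of _ "\<bar>a\<bar>"]) (auto simp: sgn_if)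
  next
    case False
    then obtain M \<delta> where M: "M > 0" "\<delta> > 0" "\<And>x. x \<ge> M \<Longrightarrow> sgn (lead_coeff p) * poly p x \<ge> \<delta>"
      using pCons by blast
    define s where "s = sgn (lead_coeff p)"
    define N where "N = max M ((\<bar>a\<bar> + 1) / \<delta>)"
    have "s * poly (pCons a p) x \<ge> 1" if "x \<ge> N" for x
    proof -
      have x: "x \<ge> M" "x \<ge> (\<bar>a\<bar> + 1) / \<delta>" "x > 0" using that M by (auto simp: N_def)
      have "\<bar>a\<bar> + 1 \<le> x * \<delta>" using x(2) M(2) by (simp add: field_simps)
      also have "\<dots> \<le> x * (s * poly p x)" using M(3)[OF x(1)] x(3) by (simp add: s_def)
      finally have "\<bar>a\<bar> + 1 \<le> x * (s * poly p x)" .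
      moreover have "s * a \<ge> - \<bar>a\<bar>" using False by (auto simp: s_def sgn_if)
      ultimately show ?thesis by (simp add: algebra_simps)
    qed
    moreover have "N > 0" using M by (simp add: N_def less_max_iff_disj)
    moreover have "lead_coeff (pCons a p) = lead_coeff p" using False by simp
    ultimately show ?thesis unfolding s_def
      by (intro exI[of _ N] conjI exI[of _ 1]) auto
  qed
qed

section \<open>Ring homomorphisms and signs\<close>

definition is_ring_hom :: "('a::comm_ring_1 \<Rightarrow> 'b::comm_ring_1) \<Rightarrow> bool" where
  "is_ring_hom \<phi> \<longleftrightarrow> \<phi> 1 = 1 \<and> (\<forall>x y. \<phi> (x + y) = \<phi> x + \<phi> y) \<and> (\<forall>x y. \<phi> (x * y) = \<phi> x * \<phi> y)"

lemma is_ring_homD: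
  assumes "is_ring_hom \<phi>"
  shows "\<phi> 1 = 1" "\<phi> (x + y) = \<phi> x + \<phi> y" "\<phi> (x * y) = \<phi> x * \<phi> y" "\<phi> 0 = 0" "\<phi> (- x) = - \<phi> x"
    "\<phi> (x - y) = \<phi> x - \<phi> y" "\<phi> (x ^ n) = \<phi> x ^ n" "\<phi> (of_nat n) = of_nat n"
    "\<phi> (sum f A) = (\<Sum>i\<in>A. \<phi> (f i))" "\<phi> (prod f A) = (\<Prod>i\<in>A. \<phi> (f i))"
proof -
  have add: "\<phi> (x + y) = \<phi> x + \<phi> y" and mult: "\<phi> (x * y) = \<phi> x * \<phi> y" and one: "\<phi> 1 = 1" for x y
    using assms by (auto simp: is_ring_hom_def)
  show "\<phi> 1 = 1" "\<phi> (x + y) = \<phi> x + \<phi> y" "\<phi> (x * y) = \<phi> x * \<phi> y" by (fact one add mult)+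
  have zero: "\<phi> 0 = 0" using add[of 0 0] by simp
  then show "\<phi> 0 = 0" .
  have uminus: "\<phi> (- x) = - \<phi> x" for x using add[of x "- x"] zero by (simp add: add_eq_0_iff)
  then show "\<phi> (- x) = - \<phi> x" .
  show "\<phi> (x - y) = \<phi> x - \<phi> y" using add[of x "- y"] uminus by simp
  show "\<phi> (x ^ n) = \<phi> x ^ n" by (induction n) (simp_all add: one mult)
  show "\<phi> (of_nat n) = of_nat n" by (induction n) (simp_all add: zero one add)
  show "\<phi> (sum f A) = (\<Sum>i\<in>A. \<phi> (f i))"
    by (induction A rule: infinite_finite_induct) (simp_all add: zero add)
  show "\<phi> (prod f A) = (\<Prod>i\<in>A. \<phi> (f i))"
    by (induction A rule: infinite_finite_induct) (simp_all add: one mult)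
qed

lemma is_ring_hom_comp: "is_ring_hom \<phi> \<Longrightarrow> is_ring_hom \<psi> \<Longrightarrow> is_ring_hom (\<lambda>x. \<psi> (\<phi> x))"
  by (simp add: is_ring_hom_def)

lemma map_poly_hom:
  assumes "is_ring_hom \<phi>"
  shows "map_poly \<phi> (p + q) = map_poly \<phi> p + map_poly \<phi> q"
    "map_poly \<phi> (p - q) = map_poly \<phi> p - map_poly \<phi> q"
    "map_poly \<phi> (p * q) = map_poly \<phi> p * map_poly \<phi> q"
    "map_poly \<phi> (smult c p) = smult (\<phi> c) (map_poly \<phi> p)"
    "map_poly \<phi> (monom c n) = monom (\<phi> c) n"
  by (rule poly_eqI; simp add: coeff_map_poly coeff_mult coeff_monom is_ring_homD[OF assms])+

lemma poly_map_poly_hom: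
  assumes "is_ring_hom \<phi>"
  shows "poly (map_poly \<phi> p) (\<phi> x) = \<phi> (poly p x)"
  by (induction p) (simp_all add: map_poly_pCons is_ring_homD[OF assms])

text \<open>
  Signs are compared between two different ordered fields, so the comparison cannot be an equation of
  values of \<open>sgn\<close>.
\<close>
definition same_sign :: "'a::linordered_idom \<Rightarrow> 'b::linordered_idom \<Rightarrow> bool" where
  "same_sign x y \<longleftrightarrow> (0 < x \<longleftrightarrow> 0 < y) \<and> (x < 0 \<longleftrightarrow> y < 0)"

lemma same_signD:
  assumes "same_sign x y"
  shows "0 < x \<longleftrightarrow> 0 < y" "x < 0 \<longleftrightarrow> y < 0" "x = 0 \<longleftrightarrow> y = 0"
  using assms unfolding same_sign_def by (metis linorder_neq_iff)+

lemma same_sign_0 [simp]: "same_sign 0 0"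
  by (simp add: same_sign_def)

lemma same_sign_minus: "same_sign (- x) (- y) \<longleftrightarrow> same_sign x y"
  by (auto simp: same_sign_def)

lemma same_sign_trans: "same_sign x y \<Longrightarrow> same_sign y z \<Longrightarrow> same_sign x z"
  by (simp add: same_sign_def)

lemma same_sign_commute: "same_sign x y \<longleftrightarrow> same_sign y x"
  by (auto simp: same_sign_def)

lemma same_sign_square_mult_cancel:
  assumes "c \<noteq> 0" "d \<noteq> 0" "same_sign (c ^ (2 * n) * x) (d ^ (2 * n) * y)"
  shows "same_sign x y"
proof -
  have "0 < c ^ (2 * n)" "0 < d ^ (2 * n)"
    using assms by (simp_all add: power_mult zero_less_power)
  then show ?thesis using assms(3) by (auto simp: same_sign_def zero_less_mult_iff mult_less_0_iff)
qed

section \<open>Univariate polynomials closed under derivatives and remainders\<close>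

text \<open>
  The derivative over an arbitrary coefficient ring; \<open>pderiv\<close> presupposes that there are no zero divisors.
\<close>
definition formal_deriv :: "'a::comm_ring_1 poly \<Rightarrow> 'a poly" where
  "formal_deriv p = Poly (map (\<lambda>i. of_nat (Suc i) * coeff p (Suc i)) [0..<degree p])"

lemma coeff_formal_deriv: "coeff (formal_deriv p) i = of_nat (Suc i) * coeff p (Suc i)"
  by (auto simp: formal_deriv_def nth_default_def coeff_eq_0 simp del: of_nat_Suc)

lemma degree_formal_deriv: "0 < degree p \<Longrightarrow> degree (formal_deriv p) < degree p"
  by (rule degree_lessI) (auto simp: coeff_formal_deriv coeff_eq_0)

lemma map_poly_formal_deriv:
  assumes "is_ring_hom \<phi>"
  shows "map_poly \<phi> (formal_deriv p) = pderiv (map_poly \<phi> p)"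
  by (rule poly_eqI)
    (simp add: coeff_map_poly coeff_formal_deriv coeff_pderiv is_ring_homD[OF assms] del: of_nat_Suc)

text \<open>
  If a specialisation of the coefficients annihilates the leading coefficient, then the polynomial
  specialises to the same polynomial as this one of smaller degree.
\<close>
definition drop_lead :: "'a::comm_ring_1 poly \<Rightarrow> 'a poly" where
  "drop_lead p = p - monom (lead_coeff p) (degree p)"

lemma coeff_drop_lead: "coeff (drop_lead p) i = (if i = degree p then 0 else coeff p i)"
  by (simp add: drop_lead_def coeff_monom)

lemma degree_drop_lead: "0 < degree p \<Longrightarrow> degree (drop_lead p) < degree p"
  by (rule degree_lessI) (auto simp: coeff_drop_lead coeff_eq_0)

lemma map_poly_drop_lead:
  assumes "is_ring_hom \<phi>" and "\<phi> (lead_coeff p) = 0"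
  shows "map_poly \<phi> (drop_lead p) = map_poly \<phi> p"
  unfolding drop_lead_def by (simp add: map_poly_hom[OF assms(1)] assms(2))

text \<open>
  The pseudo-remainder, multiplied by one more power of the leading coefficient of \<open>q\<close>. The total factor in front
  of \<open>p\<close> is then an even power, so at a common root of \<open>q\<close> the sign of \<open>p\<close> is the sign of the remainder.
\<close>
definition even_rem :: "'a::comm_ring_1 poly \<Rightarrow> 'a poly \<Rightarrow> 'a poly" where
  "even_rem p q = smult (lead_coeff q ^ (Suc (degree p) - degree q)) (snd (pseudo_divmod p q))"

lemma even_rem_eq:
  assumes "0 < degree q"
  shows "\<exists>u. smult (lead_coeff q ^ (2 * (Suc (degree p) - degree q))) p = q * u + even_rem p q"
proof -
  define e where "e = Suc (degree p) - degree q"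
  have "smult (lead_coeff q ^ e) p = q * fst (pseudo_divmod p q) + snd (pseudo_divmod p q)"
    unfolding e_def using pseudo_divmod(1)[of q p] assms by (metis degree_0 less_irrefl prod.collapse)
  then have "smult (lead_coeff q ^ e) (smult (lead_coeff q ^ e) p) =
    q * smult (lead_coeff q ^ e) (fst (pseudo_divmod p q)) + even_rem p q"
    by (simp add: even_rem_def e_def smult_add_right)
  then show ?thesis
    unfolding e_def[symmetric]
    by (intro exI[of _ "smult (lead_coeff q ^ e) (fst (pseudo_divmod p q))"]) (simp add: power_add mult_2)
qed

lemma degree_even_rem:
  assumes "0 < degree q"
  shows "degree (even_rem p q) < degree q"
proof -
  have "snd (pseudo_divmod p q) = 0 \<or> degree (snd (pseudo_divmod p q)) < degree q"
    using pseudo_divmod(2)[of q p] assms by (metis degree_0 less_irrefl prod.collapse)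
  then have "degree (snd (pseudo_divmod p q)) < degree q" using assms by auto
  then show ?thesis unfolding even_rem_def by (meson degree_smult_le le_less_trans)
qed

definition descendants :: "'a::comm_ring_1 poly set \<Rightarrow> 'a poly set" where
  "descendants U = formal_deriv ` {p \<in> U. 0 < degree p} \<union> drop_lead ` {p \<in> U. 0 < degree p}
     \<union> {even_rem p q | p q. p \<in> U \<and> q \<in> U \<and> 0 < degree q \<and> degree q \<le> degree p}"

lemma finite_descendants:
  assumes "finite U"
  shows "finite (descendants U)"
proof -
  have "{even_rem p q | p q. p \<in> U \<and> q \<in> U \<and> 0 < degree q \<and> degree q \<le> degree p}
      \<subseteq> (\<lambda>(p, q). even_rem p q) ` (U \<times> U)"
    by auto
  then have "finite {even_rem p q | p q. p \<in> U \<and> q \<in> U \<and> 0 < degree q \<and> degree q \<le> degree p}"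
    by (rule finite_subset) (simp add: assms)
  then show ?thesis unfolding descendants_def using assms by auto
qed

lemma descendants_lower_degree:
  assumes "x \<in> descendants U"
  shows "x \<in> descendants {p \<in> U. degree x < degree p}"
proof -
  consider p where "x = formal_deriv p \<or> x = drop_lead p" "p \<in> U" "0 < degree p"
    | p q where "x = even_rem p q" "p \<in> U" "q \<in> U" "0 < degree q" "degree q \<le> degree p"
    using assms by (auto simp: descendants_def)
  then show ?thesis
  proof cases
    case 1
    then have "degree x < degree p" using degree_formal_deriv degree_drop_lead by blast
    then show ?thesis using 1 by (auto simp: descendants_def)
  next
    case 2
    then have "degree x < degree q" using degree_even_rem by blast
    moreover from this have "degree x < degree p" using 2 by simp
    ultimately show ?thesis using 2 unfolding descendants_def by blast
  qed
qed

lemma descendants_mono: "U \<subseteq> V \<Longrightarrow> descendants U \<subseteq> descendants V"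
  unfolding descendants_def by blast

lemma descendants_Un_high:
  assumes "descendants {p \<in> U. Suc d \<le> degree p} \<subseteq> U"
  shows "descendants {p \<in> U \<union> descendants U. d \<le> degree p} \<subseteq> U \<union> descendants U"
proof -
  have low: "x \<in> U" if "x \<in> descendants U" "d \<le> degree x" for x
  proof -
    have "{p \<in> U. degree x < degree p} \<subseteq> {p \<in> U. Suc d \<le> degree p}" using that(2) by auto
    then have "x \<in> descendants {p \<in> U. Suc d \<le> degree p}"
      using descendants_lower_degree[OF that(1)] descendants_mono by blast
    then show ?thesis using assms by blast
  qed
  then have "{p \<in> U \<union> descendants U. d \<le> degree p} \<subseteq> U" by auto
  then show ?thesis using descendants_mono by blast
qed

text \<open>
  Every derived polynomial has smaller degree than its parents. So one round of deriving
  closes the family in the top degree, and each further round in one more degree, without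
  touching the degrees that are already closed.
\<close>
lemma exists_closed_family:
  fixes U0 :: "'a::comm_ring_1 poly set"
  assumes "finite U0" and "\<And>U. U \<subseteq> S \<Longrightarrow> descendants U \<subseteq> S" and "U0 \<subseteq> S"
  shows "\<exists>U. finite U \<and> U0 \<subseteq> U \<and> U \<subseteq> S \<and> descendants U \<subseteq> U"
proof -
  obtain D where D: "\<And>p. p \<in> U0 \<Longrightarrow> degree p < D"
    using finite_nat_set_iff_bounded[of "degree ` U0"] assms(1) by auto
  have "\<exists>U. finite U \<and> U0 \<subseteq> U \<and> U \<subseteq> S \<and> descendants {p \<in> U. D - k \<le> degree p} \<subseteq> U" for k
  proof (induction k)
    case 0
    have "{p \<in> U0. D - 0 \<le> degree p} = {}" using D by (auto simp: not_le)
    moreover have "descendants {} = ({} :: 'a poly set)" by (simp add: descendants_def)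
    ultimately have "descendants {p \<in> U0. D - 0 \<le> degree p} \<subseteq> U0" by (metis empty_subsetI)
    then show ?case using assms by blast
  next
    case (Suc k)
    then obtain U where U: "finite U" "U0 \<subseteq> U" "U \<subseteq> S" "descendants {p \<in> U. D - k \<le> degree p} \<subseteq> U" by blast
    show ?case
    proof (cases "k < D")
      case True
      then have "descendants {p \<in> U \<union> descendants U. D - Suc k \<le> degree p} \<subseteq> U \<union> descendants U"
        using U(4) by (intro descendants_Un_high) (simp add: Suc_diff_Suc)
      then show ?thesis using U assms(2) finite_descendants[OF U(1)]
        by (intro exI[of _ "U \<union> descendants U"]) auto
    next
      case False
      then show ?thesis using U by (intro exI[of _ U]) auto
    qed
  qed
  from this[of D] show ?thesis by simp
qed

section \<open>Sign diagrams\<close>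

lemma map_poly_hom_degree:
  assumes "is_ring_hom \<phi>" "\<phi> (lead_coeff p) \<noteq> 0"
  shows "degree (map_poly \<phi> p) = degree p" "coeff (map_poly \<phi> p) (degree p) = \<phi> (lead_coeff p)"
proof -
  show *: "coeff (map_poly \<phi> p) (degree p) = \<phi> (lead_coeff p)"
    by (simp add: coeff_map_poly is_ring_homD[OF assms(1)])
  then show "degree (map_poly \<phi> p) = degree p"
    using assms(2) by (intro antisym degree_le le_degree)
      (simp_all add: coeff_map_poly is_ring_homD[OF assms(1)] coeff_eq_0)
qed

lemma same_sign_far_single:
  fixes p :: "'a::linordered_field poly"
  shows "\<exists>M > 0. \<forall>x \<ge> M. same_sign (poly p x) (lead_coeff p) \<and>
     same_sign (poly p (- x)) ((- 1) ^ degree p * lead_coeff p)"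
proof -
  have *: "\<exists>M > 0. \<forall>x \<ge> M. same_sign (poly p x) (lead_coeff p)" for p :: "'a poly"
  proof -
    obtain M \<delta> where M: "M > 0" "\<delta> > 0" "\<And>x. x \<ge> M \<Longrightarrow> p \<noteq> 0 \<Longrightarrow> sgn (lead_coeff p) * poly p x \<ge> \<delta>"
      using eventually_sign_lead_coeff by blast
    have "same_sign (poly p x) (lead_coeff p)" if "x \<ge> M" for x
    proof (cases "p = 0")
      case False
      then have "0 < sgn (lead_coeff p) * poly p x" using M(2) M(3)[OF that] by simp
      moreover have "lead_coeff p \<noteq> 0" using False by simp
      ultimately show ?thesis by (auto simp: same_sign_def sgn_if not_less order_less_le split: if_splits)
    qed simp
    then show ?thesis using M(1) by blast
  qed
  obtain M where M: "M > 0" "\<And>x. x \<ge> M \<Longrightarrow> same_sign (poly p x) (lead_coeff p)"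
    using * by blast
  define q where "q = pcompose p [:0, - 1:]"
  obtain N where N: "N > 0" "\<And>x. x \<ge> N \<Longrightarrow> same_sign (poly q x) (lead_coeff q)"
    using * by blast
  have "lead_coeff q = (- 1) ^ degree p * lead_coeff p"
    unfolding q_def by (subst lead_coeff_comp) simp_all
  moreover have "poly q x = poly p (- x)" for x by (simp add: q_def poly_pcompose)
  ultimately show ?thesis using M N by (intro exI[of _ "max M N"]) auto
qed

lemma same_sign_far:
  fixes U :: "'a::linordered_field poly set"
  assumes "finite U"
  shows "\<exists>M > 0. \<forall>p\<in>U. \<forall>x \<ge> M. same_sign (poly p x) (lead_coeff p) \<and>
     same_sign (poly p (- x)) ((- 1) ^ degree p * lead_coeff p)"
  using assms
proof induction
  case empty
  then show ?case by (auto intro: exI[of _ 1])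
next
  case (insert p U)
  then obtain M where M: "M > 0" "\<forall>p\<in>U. \<forall>x \<ge> M. same_sign (poly p x) (lead_coeff p) \<and>
     same_sign (poly p (- x)) ((- 1) ^ degree p * lead_coeff p)" by blast
  obtain N where N: "N > 0" "\<forall>x \<ge> N. same_sign (poly p x) (lead_coeff p) \<and>
     same_sign (poly p (- x)) ((- 1) ^ degree p * lead_coeff p)" using same_sign_far_single by blast
  show ?case using M N by (intro exI[of _ "max M N"]) auto
qed

text \<open>
  A monotone polynomial changes its sign at most once, and whether it does is visible from the signs at
  the end points, which agree for \<open>P\<close> and \<open>Q\<close>.
\<close>
lemma increasing_split:
  fixes P :: "'f::real_closed_field poly" and Q :: "'g::real_closed_field poly"
  assumes ab: "a < b" "a' < b'"
    and P: "\<And>x. a < x \<Longrightarrow> x < b \<Longrightarrow> 0 < poly (pderiv P) x"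
    and Q: "\<And>y. a' < y \<Longrightarrow> y < b' \<Longrightarrow> 0 < poly (pderiv Q) y"
    and ends: "same_sign (poly P a) (poly Q a')" "same_sign (poly P b) (poly Q b')"
  shows "(\<forall>x y. a < x \<longrightarrow> x < b \<longrightarrow> a' < y \<longrightarrow> y < b' \<longrightarrow> same_sign (poly P x) (poly Q y)) \<or>
    (\<exists>c c'. a < c \<and> c < b \<and> a' < c' \<and> c' < b' \<and> poly P c = 0 \<and> poly Q c' = 0 \<and>
      (\<forall>x y. a < x \<longrightarrow> x < c \<longrightarrow> a' < y \<longrightarrow> y < c' \<longrightarrow> same_sign (poly P x) (poly Q y)) \<and>
      (\<forall>x y. c < x \<longrightarrow> x < b \<longrightarrow> c' < y \<longrightarrow> y < b' \<longrightarrow> same_sign (poly P x) (poly Q y)))"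
proof -
  have mono1: "poly P x < poly P y" if "a \<le> x" "x < y" "y \<le> b" for x y
    using pderiv_pos_strict_mono[of a b P] P that by blast
  have mono2: "poly Q x < poly Q y" if "a' \<le> x" "x < y" "y \<le> b'" for x y
    using pderiv_pos_strict_mono[of a' b' Q] Q that by blast
  consider "0 \<le> poly P a" | "poly P b \<le> 0" | "poly P a < 0" "0 < poly P b" by linarith
  then show ?thesis
  proof cases
    case 1
    then have "0 \<le> poly Q a'" using same_signD(2)[OF ends(1)] by (simp add: not_less[symmetric])
    then have "0 < poly P x" "0 < poly Q y" if "a < x" "x < b" "a' < y" "y < b'" for x y
      using mono1[of a x] mono2[of a' y] 1 that by auto
    then show ?thesis by (auto simp: same_sign_def dest: order_less_imp_not_less)
  next
    case 2
    then have "poly Q b' \<le> 0" using same_signD(1)[OF ends(2)] by (simp add: not_less[symmetric])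
    then have "poly P x < 0" "poly Q y < 0" if "a < x" "x < b" "a' < y" "y < b'" for x y
      using mono1[of x b] mono2[of y b'] 2 that by auto
    then show ?thesis by (auto simp: same_sign_def dest: order_less_imp_not_less)
  next
    case 3
    then have 3: "poly P a < 0" "0 < poly P b" "poly Q a' < 0" "0 < poly Q b'"
      using same_signD[OF ends(1)] same_signD[OF ends(2)] by auto
    obtain c where c: "a < c" "c < b" "poly P c = 0"
      using poly_sign_change_root[OF ab(1), of P] 3 by (auto simp: mult_neg_pos)
    obtain c' where c': "a' < c'" "c' < b'" "poly Q c' = 0"
      using poly_sign_change_root[OF ab(2), of Q] 3 by (auto simp: mult_neg_pos)
    have "same_sign (poly P x) (poly Q y)" if "a < x" "x < c" "a' < y" "y < c'" for x y
      using mono1[of x c] mono2[of y c'] c c' that by (auto simp: same_sign_def)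
    moreover have "same_sign (poly P x) (poly Q y)" if "c < x" "x < b" "c' < y" "y < b'" for x y
      using mono1[of c x] mono2[of c' y] c c' that by (auto simp: same_sign_def)
    ultimately show ?thesis using c c' by blast
  qed
qed

text \<open>
  Two specialisations of the coefficients, to real closed fields \<open>'f\<close> and \<open>'g\<close>, that give the leading
  coefficients of a closed family the same signs. The constant members of the family are among the
  leading coefficients.
\<close>
locale sign_matching =
  fixes \<phi> :: "'a::comm_ring_1 \<Rightarrow> 'f::real_closed_field" and \<psi> :: "'a \<Rightarrow> 'g::real_closed_field"
    and U :: "'a poly set"
  assumes hom1: "is_ring_hom \<phi>" and hom2: "is_ring_hom \<psi>"
    and closed: "descendants U \<subseteq> U"
    and finite_U: "finite U"
    and lead: "\<And>p. p \<in> U \<Longrightarrow> same_sign (\<phi> (lead_coeff p)) (\<psi> (lead_coeff p))"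
begin

abbreviation ev1 :: "'a poly \<Rightarrow> 'f \<Rightarrow> 'f" where "ev1 p \<equiv> poly (map_poly \<phi> p)"
abbreviation ev2 :: "'a poly \<Rightarrow> 'g \<Rightarrow> 'g" where "ev2 p \<equiv> poly (map_poly \<psi> p)"

lemma closedD:
  assumes "p \<in> U" "0 < degree p"
  shows "formal_deriv p \<in> U" "drop_lead p \<in> U"
    "q \<in> U \<Longrightarrow> 0 < degree q \<Longrightarrow> degree q \<le> degree p \<Longrightarrow> even_rem p q \<in> U"
  using assms closed unfolding descendants_def by blast+

lemma same_sign_constant:
  assumes "p \<in> U" "degree p = 0"
  shows "same_sign (ev1 p x) (ev2 p y)"
proof -
  obtain c where "p = [:c:]" using degree_eq_zeroE[OF assms(2)] by blast
  then show ?thesis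
    using lead[OF assms(1)] is_ring_homD(4)[OF hom1] is_ring_homD(4)[OF hom2]
    by (simp add: map_poly_pCons)
qed

definition matched :: "'f \<Rightarrow> 'g \<Rightarrow> bool" where
  "matched x y \<longleftrightarrow> (\<forall>p\<in>U. same_sign (ev1 p x) (ev2 p y))"

text \<open>
  Quantifying over \<^emph>\<open>all\<close> pairs of inner points also says that the signs are constant on either interval.
\<close>
definition matched_intervals :: "'a poly set \<Rightarrow> 'f \<Rightarrow> 'f \<Rightarrow> 'g \<Rightarrow> 'g \<Rightarrow> bool" where
  "matched_intervals V a b a' b' \<longleftrightarrow>
     (\<forall>x y p. a < x \<longrightarrow> x < b \<longrightarrow> a' < y \<longrightarrow> y < b' \<longrightarrow> p \<in> V \<longrightarrow> same_sign (ev1 p x) (ev2 p y))"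

text \<open>
  Corresponding subdivisions of an interval of \<open>'f\<close> and an interval of \<open>'g\<close>. At the division
  points the whole family \<open>U\<close> is matched, between them only the subfamily \<open>V\<close> that has been treated so far.
\<close>
fun diagram :: "'a poly set \<Rightarrow> ('f \<times> 'g) list \<Rightarrow> bool" where
  "diagram V [] \<longleftrightarrow> True"
| "diagram V [(a, a')] \<longleftrightarrow> matched a a'"
| "diagram V ((a, a') # (b, b') # l) \<longleftrightarrow>
     matched a a' \<and> a < b \<and> a' < b' \<and> matched_intervals V a b a' b' \<and> diagram V ((b, b') # l)"

lemma same_sign_even_rem:
  assumes "q \<in> U" "0 < degree q" "\<phi> (lead_coeff q) \<noteq> 0"
    and roots: "ev1 q c = 0" "ev2 q c' = 0"
    and rem: "same_sign (ev1 (even_rem p q) c) (ev2 (even_rem p q) c')"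
  shows "same_sign (ev1 p c) (ev2 p c')"
proof -
  define k where "k = Suc (degree p) - degree q"
  have "\<psi> (lead_coeff q) \<noteq> 0" using lead[OF assms(1)] assms(3) by (simp add: same_signD)
  obtain u where u: "smult (lead_coeff q ^ (2 * k)) p = q * u + even_rem p q"
    using even_rem_eq[OF assms(2), of p] unfolding k_def by blast
  have "\<phi> (lead_coeff q) ^ (2 * k) * ev1 p c = ev1 (even_rem p q) c"
    using arg_cong[OF u, of "\<lambda>p. ev1 p c"] roots
    by (simp add: map_poly_hom[OF hom1] is_ring_homD[OF hom1])
  moreover have "\<psi> (lead_coeff q) ^ (2 * k) * ev2 p c' = ev2 (even_rem p q) c'"
    using arg_cong[OF u, of "\<lambda>p. ev2 p c'"] roots
    by (simp add: map_poly_hom[OF hom2] is_ring_homD[OF hom2])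
  ultimately show ?thesis
    using same_sign_square_mult_cancel[OF assms(3) \<open>\<psi> (lead_coeff q) \<noteq> 0\<close>] rem by metis
qed

lemma matched_intervals_subset:
  assumes "matched_intervals V a b a' b'" "a \<le> c" "d \<le> b" "a' \<le> c'" "d' \<le> b'"
  shows "matched_intervals V c d c' d'"
  using assms unfolding matched_intervals_def by (meson le_less_trans less_le_trans)

lemma matched_intervals_insert:
  "matched_intervals (insert p V) a b a' b' \<longleftrightarrow> matched_intervals V a b a' b' \<and>
     (\<forall>x y. a < x \<longrightarrow> x < b \<longrightarrow> a' < y \<longrightarrow> y < b' \<longrightarrow> same_sign (ev1 p x) (ev2 p y))"
  unfolding matched_intervals_def by blast

text \<open>
  The derivative of \<open>p\<close> is in \<open>V\<close>, so \<open>p\<close> is monotone on both intervals, in the same direction, and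
  \<open>increasing_split\<close> either fixes its sign or produces one root on each side. At these roots the members of
  smaller degree are matched as inner points of the old intervals, and every other \<open>q \<in> U\<close> has the sign of its
  remainder modulo \<open>p\<close>, which is a member of smaller degree.
\<close>
lemma refine_interval:
  assumes p: "p \<in> U" and V: "\<And>q. q \<in> U \<Longrightarrow> degree q < degree p \<Longrightarrow> q \<in> V"
    and ab: "a < b" "a' < b'" and ends: "matched a a'" "matched b b'"
    and int: "matched_intervals V a b a' b'"
  shows "matched_intervals (insert p V) a b a' b' \<or>
    (\<exists>c c'. a < c \<and> c < b \<and> a' < c' \<and> c' < b' \<and> matched c c' \<and>
       matched_intervals (insert p V) a c a' c' \<and> matched_intervals (insert p V) c b c' b')"
proof (cases "degree p = 0")
  case True
  then show ?thesis using same_sign_constant[OF p] int by (simp add: matched_intervals_insert)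
next
  case False
  then have deg: "0 < degree p" by simp
  have sgnV: "same_sign (ev1 q x) (ev2 q y)"
    if "q \<in> U" "degree q < degree p" "a < x" "x < b" "a' < y" "y < b'" for q x y
    using int that V unfolding matched_intervals_def by blast
  show ?thesis
  proof (cases "\<phi> (lead_coeff p) = 0")
    case True
    then have "\<psi> (lead_coeff p) = 0" using lead[OF p] by (simp add: same_signD)
    then show ?thesis
      using sgnV[OF closedD(2)[OF p deg] degree_drop_lead[OF deg]] int True
      by (simp add: matched_intervals_insert map_poly_drop_lead[OF hom1] map_poly_drop_lead[OF hom2])
  next
    case False
    define P where "P = map_poly \<phi> p"
    define Q where "Q = map_poly \<psi> p"
    have der: "same_sign (poly (pderiv P) x) (poly (pderiv Q) y)"
      if "a < x" "x < b" "a' < y" "y < b'" for x y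
      using sgnV[OF closedD(1)[OF p deg] degree_formal_deriv[OF deg]] that
      by (simp add: P_def Q_def map_poly_formal_deriv[OF hom1] map_poly_formal_deriv[OF hom2])
    \<comment> \<open>the derivative is not identically zero, so its common sign on the intervals is not 0\<close>
    have "coeff P (degree p) \<noteq> 0"
      using False by (simp add: P_def coeff_map_poly is_ring_homD[OF hom1])
    then have "pderiv P \<noteq> 0" using deg le_degree[of P "degree p"] by (auto simp: pderiv_eq_0_iff)
    then have "finite {x. poly (pderiv P) x = 0}" by (rule poly_roots_finite)
    moreover have "infinite {a<..<b}" using ab by (simp add: infinite_Ioo)
    ultimately obtain x0 where x0: "a < x0" "x0 < b" "poly (pderiv P) x0 \<noteq> 0"
      by (metis (mono_tags, lifting) finite_subset greaterThanLessThan_iff mem_Collect_eq subsetI)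
    obtain y0 where y0: "a' < y0" "y0 < b'" using dense[OF ab(2)] by blast
    have endsP: "same_sign (poly P a) (poly Q a')" "same_sign (poly P b) (poly Q b')"
      using ends p by (auto simp: matched_def P_def Q_def)
    have split: "(\<forall>x y. a < x \<longrightarrow> x < b \<longrightarrow> a' < y \<longrightarrow> y < b' \<longrightarrow> same_sign (poly P x) (poly Q y)) \<or>
    (\<exists>c c'. a < c \<and> c < b \<and> a' < c' \<and> c' < b' \<and> poly P c = 0 \<and> poly Q c' = 0 \<and>
      (\<forall>x y. a < x \<longrightarrow> x < c \<longrightarrow> a' < y \<longrightarrow> y < c' \<longrightarrow> same_sign (poly P x) (poly Q y)) \<and>
      (\<forall>x y. c < x \<longrightarrow> x < b \<longrightarrow> c' < y \<longrightarrow> y < b' \<longrightarrow> same_sign (poly P x) (poly Q y)))"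
    proof (cases "0 < poly (pderiv P) x0")
      case True
      have Q: "0 < poly (pderiv Q) y" if "a' < y" "y < b'" for y
        using der[OF x0(1,2) that] True by (simp add: same_signD)
      have P: "0 < poly (pderiv P) x" if "a < x" "x < b" for x
        using der[OF that y0] Q[OF y0] by (simp add: same_signD)
      show ?thesis using increasing_split[OF ab P Q endsP] .
    next
      case False
      then have neg: "poly (pderiv P) x0 < 0" using x0 by simp
      have Q: "0 < poly (pderiv (- Q)) y" if "a' < y" "y < b'" for y
        using der[OF x0(1,2) that] neg by (simp add: same_signD pderiv_minus)
      have P: "0 < poly (pderiv (- P)) x" if "a < x" "x < b" for x
        using der[OF that y0] Q[OF y0] by (simp add: same_signD pderiv_minus)
      show ?thesis using increasing_split[OF ab P Q] endsP by (simp add: same_sign_minus)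
    qed
    have root: "matched c c'"
      if c: "a < c" "c < b" "a' < c'" "c' < b'" "poly P c = 0" "poly Q c' = 0" for c c'
      unfolding matched_def
    proof
      fix q assume q: "q \<in> U"
      show "same_sign (ev1 q c) (ev2 q c')"
      proof (cases "degree q < degree p")
        case True
        then show ?thesis using sgnV q c by blast
      next
        case False
        then have "even_rem q p \<in> U" "degree (even_rem q p) < degree p"
          using closedD(3)[OF q _ p deg] deg degree_even_rem[OF deg] by auto
        then show ?thesis
          using same_sign_even_rem[OF p deg \<open>\<phi> (lead_coeff p) \<noteq> 0\<close>] sgnV c
          by (simp add: P_def Q_def)
      qed
    qed
    from split show ?thesis
    proof (elim disjE exE conjE)
      assume "\<forall>x y. a < x \<longrightarrow> x < b \<longrightarrow> a' < y \<longrightarrow> y < b' \<longrightarrow> same_sign (poly P x) (poly Q y)"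
      then show ?thesis using int by (simp add: matched_intervals_insert P_def Q_def)
    next
      fix c c'
      assume c: "a < c" "c < b" "a' < c'" "c' < b'" "poly P c = 0" "poly Q c' = 0"
        and l: "\<forall>x y. a < x \<longrightarrow> x < c \<longrightarrow> a' < y \<longrightarrow> y < c' \<longrightarrow> same_sign (poly P x) (poly Q y)"
        and r: "\<forall>x y. c < x \<longrightarrow> x < b \<longrightarrow> c' < y \<longrightarrow> y < b' \<longrightarrow> same_sign (poly P x) (poly Q y)"
      have "matched_intervals (insert p V) a c a' c'" "matched_intervals (insert p V) c b c' b'"
        using matched_intervals_subset[OF int] c l r
        by (simp_all add: matched_intervals_insert P_def Q_def)
      then show ?thesis using root c by blast
    qed
  qed
qed

lemma refine_diagram:
  assumes p: "p \<in> U" and "\<And>q. q \<in> U \<Longrightarrow> degree q < degree p \<Longrightarrow> q \<in> V"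
    and "diagram V l" "l \<noteq> []"
  shows "\<exists>l'. diagram (insert p V) l' \<and> l' \<noteq> [] \<and> hd l' = hd l \<and> last l' = last l"
  using assms(2-4)
proof (induction V l rule: diagram.induct)
  case (3 V a a' b b' l)
  have V: "q \<in> V" if "q \<in> U" "degree q < degree p" for q using that 3 by blast
  obtain l' where l': "diagram (insert p V) l'" "l' \<noteq> []" "hd l' = (b, b')" "last l' = last ((b, b') # l)"
    using 3 V by auto
  then obtain r where r: "l' = (b, b') # r" by (cases l') auto
  have "matched b b'" using l'(1) unfolding r by (cases r) auto
  moreover have "matched a a'" "a < b" "a' < b'" "matched_intervals V a b a' b'" using 3 by auto
  ultimately consider "matched_intervals (insert p V) a b a' b'"
    | c c' where "a < c" "c < b" "a' < c'" "c' < b'" "matched c c'"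
       "matched_intervals (insert p V) a c a' c'" "matched_intervals (insert p V) c b c' b'"
    using refine_interval[OF p V, of a b a' b'] \<open>matched b b'\<close> by blast
  then show ?case
  proof cases
    case 1
    then show ?thesis
      using l' \<open>matched a a'\<close> \<open>a < b\<close> \<open>a' < b'\<close> unfolding r
      by (intro exI[of _ "(a, a') # (b, b') # r"]) auto
  next
    case 2
    then show ?thesis
      using l' \<open>matched a a'\<close> unfolding r
      by (intro exI[of _ "(a, a') # (c, c') # (b, b') # r"]) auto
  qed
next
  case (2 V a a')
  then show ?case by (intro exI[of _ "[(a, a')]"]) auto
qed auto

text \<open>
  The members of the family are added by increasing degree, so that everything derived from a polynomial
  is treated before it.
\<close>
lemma exists_diagram:
  assumes "a < b" "a' < b'" "matched a a'" "matched b b'"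
  shows "\<exists>l. diagram U l \<and> l \<noteq> [] \<and> hd l = (a, a') \<and> last l = (b, b')"
proof -
  have "(\<forall>p\<in>V. \<forall>q\<in>U. degree q < degree p \<longrightarrow> q \<in> V) \<longrightarrow> V \<subseteq> U \<longrightarrow>
      (\<exists>l. diagram V l \<and> l \<noteq> [] \<and> hd l = (a, a') \<and> last l = (b, b'))"
    if "finite V" for V
    using that
  proof (induction V rule: finite_ranking_induct[where f = degree])
    case empty
    have "diagram {} [(a, a'), (b, b')]" using assms by (simp add: matched_intervals_def)
    then show ?case by (intro impI exI[of _ "[(a, a'), (b, b')]"]) auto
  next
    case (insert p V)
    show ?case
    proof (intro impI)
      assume low: "\<forall>r\<in>insert p V. \<forall>q\<in>U. degree q < degree r \<longrightarrow> q \<in> insert p V"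
        and sub: "insert p V \<subseteq> U"
      have "\<forall>r\<in>V. \<forall>q\<in>U. degree q < degree r \<longrightarrow> q \<in> V"
        using low insert.hyps(2) by (metis insert_iff leD)
      then obtain l where l: "diagram V l" "l \<noteq> []" "hd l = (a, a')" "last l = (b, b')"
        using insert.IH sub by auto
      have "q \<in> V" if "q \<in> U" "degree q < degree p" for q using low that by auto
      then show "\<exists>l. diagram (insert p V) l \<and> l \<noteq> [] \<and> hd l = (a, a') \<and> last l = (b, b')"
        using refine_diagram[of p V l] l sub by auto
    qed
  qed
  from this[OF finite_U] show ?thesis by blast
qed

lemma diagram_point:
  assumes "diagram V l" "V = U" "l \<noteq> []" "fst (hd l) \<le> x" "x \<le> fst (last l)"
  shows "\<exists>y. matched x y"
  using assms
proof (induction V l rule: diagram.induct)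
  case (3 V a a' b b' l)
  show ?case
  proof (cases "b \<le> x")
    case True
    then show ?thesis using 3 by auto
  next
    case False
    show ?thesis
    proof (cases "x = a")
      case True
      then show ?thesis using 3 by auto
    next
      case x: False
      obtain y where y: "a' < y" "y < b'" using dense[of a' b'] 3 by auto
      then show ?thesis using 3 x False by (intro exI[of _ y]) (auto simp: matched_def matched_intervals_def)
    qed
  qed
qed auto

text \<open>
  Far out every polynomial has the sign of its leading coefficient, up to a factor \<open>(-1)\<^sup>n\<close> on the
  negative side. When the specialised leading coefficient is zero, \<open>drop_lead\<close> takes the place of the polynomial.
\<close>
lemma matched_far:
  shows "\<exists>M > 0. \<exists>M' > 0. \<forall>x y. M \<le> x \<longrightarrow> M' \<le> y \<longrightarrow> matched x y \<and> matched (- x) (- y)"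
proof -
  obtain M where M: "M > 0" "\<And>p x. p \<in> U \<Longrightarrow> x \<ge> M \<Longrightarrow> same_sign (ev1 p x) (lead_coeff (map_poly \<phi> p)) \<and>
      same_sign (ev1 p (- x)) ((- 1) ^ degree (map_poly \<phi> p) * lead_coeff (map_poly \<phi> p))"
    using same_sign_far[of "map_poly \<phi> ` U"] finite_U by auto
  obtain M' where M': "M' > 0" "\<And>p x. p \<in> U \<Longrightarrow> x \<ge> M' \<Longrightarrow> same_sign (ev2 p x) (lead_coeff (map_poly \<psi> p)) \<and>
      same_sign (ev2 p (- x)) ((- 1) ^ degree (map_poly \<psi> p) * lead_coeff (map_poly \<psi> p))"
    using same_sign_far[of "map_poly \<psi> ` U"] finite_U by auto
  have "same_sign (ev1 p x) (ev2 p y) \<and> same_sign (ev1 p (- x)) (ev2 p (- y))"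
    if "p \<in> U" "M \<le> x" "M' \<le> y" for p x y
    using that(1)
  proof (induction "degree p" arbitrary: p rule: less_induct)
    case less
    show ?case
    proof (cases "degree p = 0")
      case True
      then show ?thesis using same_sign_constant less.prems by blast
    next
      case False
      then have deg: "0 < degree p" by simp
      show ?thesis
      proof (cases "\<phi> (lead_coeff p) = 0")
        case True
        then have "\<psi> (lead_coeff p) = 0" using lead[OF less.prems] by (simp add: same_signD)
        then show ?thesis
          using less.hyps[OF degree_drop_lead[OF deg] closedD(2)[OF less.prems deg]] True
          by (simp add: map_poly_drop_lead[OF hom1] map_poly_drop_lead[OF hom2])
      next
        case False
        then have nz: "\<psi> (lead_coeff p) \<noteq> 0" using lead[OF less.prems] by (simp add: same_signD)
        have d1: "degree (map_poly \<phi> p) = degree p" "coeff (map_poly \<phi> p) (degree p) = \<phi> (lead_coeff p)"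
          using False map_poly_hom_degree[OF hom1] by auto
        have d2: "degree (map_poly \<psi> p) = degree p" "coeff (map_poly \<psi> p) (degree p) = \<psi> (lead_coeff p)"
          using nz map_poly_hom_degree[OF hom2] by auto
        have "same_sign ((- 1) ^ degree p * \<phi> (lead_coeff p)) ((- 1) ^ degree p * \<psi> (lead_coeff p))"
          using lead[OF less.prems] by (cases "even (degree p)") (simp_all add: same_sign_minus)
        then show ?thesis
          using M(2)[OF less.prems that(2)] M'(2)[OF less.prems that(3)] lead[OF less.prems]
          unfolding d1 d2 by (meson same_sign_commute same_sign_trans)
      qed
    qed
  qed
  then show ?thesis using M M' unfolding matched_def by blast
qed

theorem exists_matched_point: "\<exists>y. matched x y"
proof -
  obtain M M' where M: "M > 0" "M' > 0"
    "\<And>x y. M \<le> x \<Longrightarrow> M' \<le> y \<Longrightarrow> matched x y \<and> matched (- x) (- y)"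
    using matched_far by blast
  consider "M \<le> x" | "M \<le> - x" | "- M \<le> x" "x \<le> M" by linarith
  then show ?thesis
  proof cases
    case 1
    then show ?thesis using M by blast
  next
    case 2
    then show ?thesis using M(3)[OF 2 order_refl] by auto
  next
    case 3
    obtain l where "diagram U l" "l \<noteq> []" "hd l = (- M, - M')" "last l = (M, M')"
      using exists_diagram[of "- M" M "- M'" M'] M by auto
    then show ?thesis using diagram_point[of U l x] 3 by auto
  qed
qed

end

section \<open>Orderings of rings\<close>

text \<open>
  Orderings are considered relative to a subring because they are extended inside an algebraically
  closed field, which has no ordering itself.
\<close>
definition is_subring :: "'a::comm_ring_1 set \<Rightarrow> bool" where
  "is_subring B \<longleftrightarrow> 1 \<in> B \<and> (\<forall>x\<in>B. \<forall>y\<in>B. x + y \<in> B \<and> x - y \<in> B \<and> x * y \<in> B)"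

definition ring_preordering :: "'a::comm_ring_1 set \<Rightarrow> 'a set \<Rightarrow> bool" where
  "ring_preordering B P \<longleftrightarrow> P \<subseteq> B \<and> (\<forall>x\<in>B. x * x \<in> P) \<and> (\<forall>x\<in>P. \<forall>y\<in>P. x + y \<in> P \<and> x * y \<in> P)"

lemma ring_preordering_Union_chain:
  assumes "\<C> \<noteq> {}" "subset.chain {P. ring_preordering B P} \<C>"
  shows "ring_preordering B (\<Union>\<C>)"
proof -
  have C: "ring_preordering B P" if "P \<in> \<C>" for P using assms(2) that by (auto simp: subset.chain_def)
  have both: "\<exists>P\<in>\<C>. x \<in> P \<and> y \<in> P" if "x \<in> \<Union>\<C>" "y \<in> \<Union>\<C>" for x y
    using assms(2) that unfolding subset.chain_def by blast
  have "x + y \<in> \<Union>\<C> \<and> x * y \<in> \<Union>\<C>" if xy: "x \<in> \<Union>\<C>" "y \<in> \<Union>\<C>" for x y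
  proof -
    obtain P where "P \<in> \<C>" "x \<in> P" "y \<in> P" using both[OF xy] by blast
    moreover from this have "x + y \<in> P" "x * y \<in> P" using C by (auto simp: ring_preordering_def)
    ultimately show ?thesis by blast
  qed
  moreover have "x * x \<in> \<Union>\<C>" if "x \<in> B" for x
  proof -
    obtain P where "P \<in> \<C>" using assms(1) by blast
    moreover from this have "x * x \<in> P" using C that by (auto simp: ring_preordering_def)
    ultimately show ?thesis by blast
  qed
  moreover have "\<Union>\<C> \<subseteq> B" using C unfolding ring_preordering_def by (intro Union_least) blast
  ultimately show ?thesis by (simp add: ring_preordering_def)
qed

lemma ring_preordering_adjoin:
  assumes B: "is_subring B" and P: "ring_preordering B P" and "x \<in> B"
  shows "ring_preordering B {a + x * b | a b. a \<in> P \<and> b \<in> P}"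
    and "P \<subseteq> {a + x * b | a b. a \<in> P \<and> b \<in> P}" and "x \<in> {a + x * b | a b. a \<in> P \<and> b \<in> P}"
proof -
  have one: "1 \<in> B" and ring: "\<And>x y. x \<in> B \<Longrightarrow> y \<in> B \<Longrightarrow> x + y \<in> B \<and> x - y \<in> B \<and> x * y \<in> B"
    using B by (auto simp: is_subring_def)
  have PB: "P \<subseteq> B" and sq: "\<And>x. x \<in> B \<Longrightarrow> x * x \<in> P"
    and cl: "\<And>x y. x \<in> P \<Longrightarrow> y \<in> P \<Longrightarrow> x + y \<in> P \<and> x * y \<in> P"
    using P by (auto simp: ring_preordering_def)
  have "0 \<in> B" using ring[OF one one] by (metis cancel_comm_monoid_add_class.diff_cancel)
  then have zero: "0 \<in> P" using sq[of 0] by simp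
  have one': "1 \<in> P" using sq[OF one] by simp
  let ?Q = "{a + x * b | a b. a \<in> P \<and> b \<in> P}"
  show sub: "P \<subseteq> ?Q" using zero by force
  show "x \<in> ?Q" using zero one' by force
  have "?Q \<subseteq> B" using PB ring \<open>x \<in> B\<close> by blast
  moreover have "u + v \<in> ?Q \<and> u * v \<in> ?Q" if uv: "u \<in> ?Q" "v \<in> ?Q" for u v
  proof -
    obtain a b where u: "u = a + x * b" "a \<in> P" "b \<in> P" using uv(1) by blast
    obtain c d where v: "v = c + x * d" "c \<in> P" "d \<in> P" using uv(2) by blast
    have "u + v = (a + c) + x * (b + d)" "u * v = (a * c + (x * x) * (b * d)) + x * (a * d + b * c)"
      unfolding u v by (simp_all add: algebra_simps)
    moreover have "a + c \<in> P" "b + d \<in> P" "a * c + (x * x) * (b * d) \<in> P" "a * d + b * c \<in> P"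
      using u v cl sq[OF \<open>x \<in> B\<close>] by simp_all
    ultimately show ?thesis by blast
  qed
  ultimately show "ring_preordering B ?Q" using sub sq unfolding ring_preordering_def by blast
qed

text \<open>
  A preordering that is maximal among those avoiding \<open>- S\<close> is an ordering with prime support. If \<open>x\<close> is not in
  \<open>P\<close>, then adjoining \<open>x\<close> produces some \<open>- s = a + x b\<close>. Were neither \<open>x\<close> nor \<open>- x\<close> in \<open>P\<close>, multiplying the two
  resulting identities would put \<open>- s t\<close> into \<open>P\<close>. The same computation for two elements outside the support shows
  that their product is not in the support. The choice \<open>S = {1}\<close> only demands a proper preordering; the powers
  of \<open>p\<^sup>2\<close> keep \<open>p\<close> out of the support.
\<close>
lemma ring_preordering_extends_to_cone:
  assumes B: "is_subring B" and T: "ring_preordering B T"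
    and S: "S \<subseteq> T" "1 \<in> S" "\<And>s t. s \<in> S \<Longrightarrow> t \<in> S \<Longrightarrow> s * t \<in> S" "\<And>s. s \<in> S \<Longrightarrow> - s \<notin> T"
  shows "\<exists>P. T \<subseteq> P \<and> ring_preordering B P \<and> (\<forall>s\<in>S. - s \<notin> P) \<and> (\<forall>x\<in>B. x \<in> P \<or> - x \<in> P) \<and>
    (\<forall>x\<in>B. \<forall>y\<in>B. x * y \<in> P \<and> - (x * y) \<in> P \<longrightarrow> (x \<in> P \<and> - x \<in> P) \<or> (y \<in> P \<and> - y \<in> P))"
proof -
  define \<A> where "\<A> = {P. ring_preordering B P \<and> T \<subseteq> P \<and> (\<forall>s\<in>S. - s \<notin> P)}"
  have "\<exists>M\<in>\<A>. \<forall>Q\<in>\<A>. M \<subseteq> Q \<longrightarrow> Q = M"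
  proof (rule subset_Zorn_nonempty)
    show "\<A> \<noteq> {}" using T S by (auto simp: \<A>_def)
    fix \<C> assume C: "\<C> \<noteq> {}" "subset.chain \<A> \<C>"
    then have "subset.chain {P. ring_preordering B P} \<C>" by (auto simp: subset.chain_def \<A>_def)
    then have "ring_preordering B (\<Union>\<C>)" using ring_preordering_Union_chain C(1) by blast
    moreover have "T \<subseteq> P" "\<forall>s\<in>S. - s \<notin> P" if "P \<in> \<C>" for P
      using C(2) that by (auto simp: subset.chain_def \<A>_def)
    moreover obtain P where "P \<in> \<C>" using C(1) by blast
    ultimately show "\<Union>\<C> \<in> \<A>" unfolding \<A>_def by blast
  qed
  then obtain P where P: "P \<in> \<A>" and max: "\<And>Q. Q \<in> \<A> \<Longrightarrow> P \<subseteq> Q \<Longrightarrow> Q = P" by blast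
  have pre: "ring_preordering B P" and TP: "T \<subseteq> P" and neg: "\<And>s. s \<in> S \<Longrightarrow> - s \<notin> P"
    using P by (auto simp: \<A>_def)
  have PB: "P \<subseteq> B" and sq: "\<And>x. x \<in> B \<Longrightarrow> x * x \<in> P"
    and cl: "\<And>x y. x \<in> P \<Longrightarrow> y \<in> P \<Longrightarrow> x + y \<in> P" "\<And>x y. x \<in> P \<Longrightarrow> y \<in> P \<Longrightarrow> x * y \<in> P"
    using pre by (auto simp: ring_preordering_def)
  have SP: "s \<in> P" if "s \<in> S" for s using that S TP by blast
  have uminus: "- x \<in> B" if "x \<in> B" for x
  proof -
    have "0 \<in> B" using B unfolding is_subring_def by (metis cancel_comm_monoid_add_class.diff_cancel)
    then have "0 - x \<in> B" using B that unfolding is_subring_def by blast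
    then show ?thesis by simp
  qed
  have missing: "\<exists>s\<in>S. \<exists>a\<in>P. \<exists>b\<in>P. - s = a + x * b" if "x \<in> B" "x \<notin> P" for x
  proof -
    let ?Q = "{a + x * b | a b. a \<in> P \<and> b \<in> P}"
    have "?Q \<notin> \<A>" using max[of ?Q] ring_preordering_adjoin(2,3)[OF B pre that(1)] that(2) by blast
    then show ?thesis
      using ring_preordering_adjoin(1,2)[OF B pre that(1)] TP unfolding \<A>_def by blast
  qed
  have total: "x \<in> P \<or> - x \<in> P" if "x \<in> B" for x
  proof (rule ccontr)
    assume "\<not> (x \<in> P \<or> - x \<in> P)"
    then obtain s a b t c d where h: "s \<in> S" "a \<in> P" "b \<in> P" "- s = a + x * b"
      "t \<in> S" "c \<in> P" "d \<in> P" "- t = c + (- x) * d"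
      using missing[of x] missing[of "- x"] \<open>x \<in> B\<close> uminus by metis
    have "x * b = - (s + a)" "x * d = t + c" using h(4,8) by (simp_all add: algebra_simps)
    then have "- (s + a) * (t + c) = (x * x) * (b * d)" by (metis mult.assoc mult.left_commute)
    moreover have "- (s * t) = s * c + a * t + a * c + (- (s + a) * (t + c))" by (simp add: algebra_simps)
    ultimately have "- (s * t) = s * c + a * t + a * c + (x * x) * (b * d)" by simp
    also have "\<dots> \<in> P" using h SP cl sq[OF \<open>x \<in> B\<close>] by simp
    finally show False using neg S(3) h by blast
  qed
  have prime: "(x \<in> P \<and> - x \<in> P) \<or> (y \<in> P \<and> - y \<in> P)"
    if xy: "x \<in> B" "y \<in> B" "x * y \<in> P" "- (x * y) \<in> P" for x y
  proof (rule ccontr)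
    assume neither: "\<not> ((x \<in> P \<and> - x \<in> P) \<or> (y \<in> P \<and> - y \<in> P))"
    have ex: "\<exists>x'. (x' = x \<or> x' = - x) \<and> x' \<in> B \<and> x' \<notin> P" if "\<not> (x \<in> P \<and> - x \<in> P)" "x \<in> B" for x
      using that uminus by blast
    obtain x' where x': "x' = x \<or> x' = - x" "x' \<in> B" "x' \<notin> P" using ex[of x] neither xy by blast
    obtain y' where y': "y' = y \<or> y' = - y" "y' \<in> B" "y' \<notin> P" using ex[of y] neither xy by blast
    have "- (x' * y') \<in> P" "x' * y' \<in> P" using x'(1) y'(1) xy by auto
    obtain s a b t c d where h: "s \<in> S" "a \<in> P" "b \<in> P" "- s = a + x' * b"
      "t \<in> S" "c \<in> P" "d \<in> P" "- t = c + y' * d"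
      using missing[OF x'(2,3)] missing[OF y'(2,3)] by metis
    have "x' * b = - (s + a)" "y' * d = - (t + c)" using h(4,8) by (simp_all add: algebra_simps)
    then have "(x' * b) * (y' * d) = (s + a) * (t + c)" by (simp only: minus_mult_minus)
    then have "- (s * t) = s * c + a * t + a * c + (- (x' * y')) * (b * d)" by (simp add: algebra_simps)
    also have "\<dots> \<in> P" using h SP cl \<open>- (x' * y') \<in> P\<close> by (metis (no_types))
    finally show False using neg S(3) h by blast
  qed
  show ?thesis
    by (intro exI[of _ P] conjI ballI impI) (use TP pre neg total prime in simp_all)
qed

lemma ring_preordering_extends_to_ordering:
  assumes B: "is_subring B" and T: "ring_preordering B T" and "- 1 \<notin> T"
  shows "\<exists>P. T \<subseteq> P \<and> ring_preordering B P \<and> - 1 \<notin> P \<and> (\<forall>x\<in>B. x \<in> P \<or> - x \<in> P)"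
proof -
  have "1 \<in> B" using B by (simp add: is_subring_def)
  then have "1 * 1 \<in> T" using T unfolding ring_preordering_def by blast
  then have "{1} \<subseteq> T" by simp
  show ?thesis
    using ring_preordering_extends_to_cone[OF B T \<open>{1} \<subseteq> T\<close>] assms(3) by auto
qed

section \<open>Real closures of ordered fields\<close>

text \<open>
  The nonnegative elements of an ordered subfield of the algebraic closure, whose order extends that
  of the base field. The subfield consists of the members of \<open>P\<close> and their negatives.
\<close>
definition field_cone :: "'a::linordered_field alg_closure set \<Rightarrow> bool" where
  "field_cone P \<longleftrightarrow> to_ac ` {0..} \<subseteq> P \<and> - 1 \<notin> P \<and> (\<forall>x\<in>P. inverse x \<in> P) \<and>
     (\<forall>x\<in>P. \<forall>y\<in>P. x + y \<in> P \<and> x * y \<in> P \<and> (x - y \<in> P \<or> y - x \<in> P))"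

lemma field_cone_base: "field_cone (to_ac ` {0..})"
proof -
  have "- 1 \<notin> to_ac ` {0::'a..}"
  proof
    assume "- 1 \<in> to_ac ` {0::'a..}"
    then obtain c :: 'a where "0 \<le> c" "to_ac (- 1) = to_ac c" by auto
    then show False by (simp only: to_ac_eq_iff)
  qed
  moreover have "to_ac c - to_ac d \<in> to_ac ` {0..} \<or> to_ac d - to_ac c \<in> to_ac ` {0..}" for c d :: 'a
    using to_ac_diff[of c d] to_ac_diff[of d c]
    by (metis atLeast_iff diff_ge_0_iff_ge imageI linear)
  moreover have "to_ac c + to_ac d \<in> to_ac ` {0..}" "to_ac c * to_ac d \<in> to_ac ` {0..}"
    if "0 \<le> c" "0 \<le> d" for c d :: 'a
    using that to_ac_add[of c d] to_ac_mult[of c d]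
    by (metis add_nonneg_nonneg atLeast_iff imageI) (metis that mult_nonneg_nonneg atLeast_iff imageI to_ac_mult)
  moreover have "inverse (to_ac c) \<in> to_ac ` {0..}" if "0 \<le> c" for c :: 'a
    using that to_ac_inverse[of c] by (metis atLeast_iff imageI inverse_nonnegative_iff_nonnegative)
  ultimately show ?thesis unfolding field_cone_def by auto
qed

definition max_cone :: "'a::linordered_field alg_closure set" where
  "max_cone = (SOME M. field_cone M \<and> (\<forall>Q. field_cone Q \<and> M \<subseteq> Q \<longrightarrow> Q = M))"

lemma max_cone: "field_cone (max_cone :: 'a::linordered_field alg_closure set)"
  and max_cone_maximal: "field_cone Q \<Longrightarrow> max_cone \<subseteq> Q \<Longrightarrow> Q = (max_cone :: 'a::linordered_field alg_closure set)"
proof -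
  have "\<exists>M\<in>Collect field_cone. \<forall>Q\<in>Collect field_cone. M \<subseteq> Q \<longrightarrow> Q = (M :: 'a alg_closure set)"
  proof (rule subset_Zorn_nonempty)
    show "Collect field_cone \<noteq> ({} :: 'a alg_closure set set)" using field_cone_base by blast
    fix \<C> :: "'a alg_closure set set"
    assume C: "\<C> \<noteq> {}" "subset.chain (Collect field_cone) \<C>"
    have cone: "field_cone P" if "P \<in> \<C>" for P using C(2) that by (auto simp: subset.chain_def)
    obtain P0 where P0: "P0 \<in> \<C>" using C(1) by blast
    have "to_ac ` {0..} \<subseteq> \<Union>\<C>" using cone[OF P0] P0 by (auto simp: field_cone_def)
    moreover have "- 1 \<notin> \<Union>\<C>" using cone by (auto simp: field_cone_def)
    moreover have "inverse x \<in> \<Union>\<C>" if "x \<in> \<Union>\<C>" for x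
      using that cone unfolding field_cone_def by (metis UnionE UnionI)
    moreover have "x + y \<in> \<Union>\<C> \<and> x * y \<in> \<Union>\<C> \<and> (x - y \<in> \<Union>\<C> \<or> y - x \<in> \<Union>\<C>)"
      if xy: "x \<in> \<Union>\<C>" "y \<in> \<Union>\<C>" for x y
    proof -
      obtain P where P: "P \<in> \<C>" "x \<in> P" "y \<in> P"
        using xy C(2) unfolding subset.chain_def by blast
      then have "x + y \<in> P" "x * y \<in> P" "x - y \<in> P \<or> y - x \<in> P"
        using cone[OF P(1)] unfolding field_cone_def by blast+
      then show ?thesis using P(1) by blast
    qed
    ultimately show "\<Union>\<C> \<in> Collect field_cone" by (simp add: field_cone_def)
  qed
  then have "\<exists>M :: 'a alg_closure set. field_cone M \<and> (\<forall>Q. field_cone Q \<and> M \<subseteq> Q \<longrightarrow> Q = M)" by blast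
  then have *: "field_cone (max_cone :: 'a alg_closure set) \<and> (\<forall>Q. field_cone Q \<and> max_cone \<subseteq> Q \<longrightarrow> Q = (max_cone :: 'a alg_closure set))"
    unfolding max_cone_def by (rule someI_ex)
  then show "field_cone (max_cone :: 'a alg_closure set)" by blast
  show "field_cone Q \<Longrightarrow> max_cone \<subseteq> Q \<Longrightarrow> Q = (max_cone :: 'a alg_closure set)" using * by blast
qed

lemma max_coneD:
  fixes x y :: "'a::linordered_field alg_closure"
  shows max_cone_of_nonneg: "0 \<le> c \<Longrightarrow> to_ac c \<in> (max_cone :: 'a alg_closure set)"
    and max_cone_add: "x \<in> max_cone \<Longrightarrow> y \<in> max_cone \<Longrightarrow> x + y \<in> max_cone"
    and max_cone_mult: "x \<in> max_cone \<Longrightarrow> y \<in> max_cone \<Longrightarrow> x * y \<in> max_cone"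
    and max_cone_diff: "x \<in> max_cone \<Longrightarrow> y \<in> max_cone \<Longrightarrow> x - y \<in> max_cone \<or> y - x \<in> max_cone"
    and max_cone_inverse: "x \<in> max_cone \<Longrightarrow> inverse x \<in> max_cone"
    and max_cone_minus_1: "- 1 \<notin> (max_cone :: 'a alg_closure set)"
  using max_cone[where 'a = 'a] unfolding field_cone_def by auto

lemma max_cone_0: "0 \<in> max_cone" and max_cone_1: "1 \<in> max_cone"
  using max_cone_of_nonneg[of 0] max_cone_of_nonneg[of 1] by simp_all

lemma max_cone_antisym:
  assumes "x \<in> max_cone" "- x \<in> max_cone"
  shows "x = 0"
proof (rule ccontr)
  assume "x \<noteq> 0"
  then have "- x * inverse x = - 1" by simp
  then show False using max_cone_mult[OF assms(2) max_cone_inverse[OF assms(1)]] max_cone_minus_1 by metis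
qed

text \<open>
  A maximal ordered subfield of the algebraic closure. It is real closed, since a missing root
  could be adjoined without losing the ordering.
\<close>
typedef (overloaded) 'a real_closure = "{x :: 'a::linordered_field alg_closure. x \<in> max_cone \<or> - x \<in> max_cone}"
  using max_cone_0 by blast

setup_lifting type_definition_real_closure

instantiation real_closure :: (linordered_field) field
begin

lift_definition zero_real_closure :: "'a real_closure" is 0
  using max_cone_0 by blast
lift_definition one_real_closure :: "'a real_closure" is 1
  using max_cone_1 by blast
lift_definition plus_real_closure :: "'a real_closure \<Rightarrow> 'a real_closure \<Rightarrow> 'a real_closure" is "(+)"
proof -
  fix x y :: "'a alg_closure"
  assume "x \<in> max_cone \<or> - x \<in> max_cone" "y \<in> max_cone \<or> - y \<in> max_cone"
  then show "x + y \<in> max_cone \<or> - (x + y) \<in> max_cone"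
    using max_cone_add[of x y] max_cone_add[of "- x" "- y"] max_cone_diff[of x "- y"] max_cone_diff[of "- x" y]
    by (auto simp: algebra_simps minus_diff_commute)
qed
lift_definition uminus_real_closure :: "'a real_closure \<Rightarrow> 'a real_closure" is uminus
  by auto
lift_definition minus_real_closure :: "'a real_closure \<Rightarrow> 'a real_closure \<Rightarrow> 'a real_closure" is "(-)"
proof -
  fix x y :: "'a alg_closure"
  assume "x \<in> max_cone \<or> - x \<in> max_cone" "y \<in> max_cone \<or> - y \<in> max_cone"
  then show "x - y \<in> max_cone \<or> - (x - y) \<in> max_cone"
    using max_cone_diff[of x y] max_cone_diff[of "- x" "- y"] max_cone_add[of x "- y"] max_cone_add[of "- x" y]
    by (auto simp: algebra_simps)
qed
lift_definition times_real_closure :: "'a real_closure \<Rightarrow> 'a real_closure \<Rightarrow> 'a real_closure" is "(*)"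
proof -
  fix x y :: "'a alg_closure"
  assume "x \<in> max_cone \<or> - x \<in> max_cone" "y \<in> max_cone \<or> - y \<in> max_cone"
  then show "x * y \<in> max_cone \<or> - (x * y) \<in> max_cone"
    using max_cone_mult[of x y] max_cone_mult[of "- x" "- y"] max_cone_mult[of x "- y"] max_cone_mult[of "- x" y]
    by auto
qed
lift_definition inverse_real_closure :: "'a real_closure \<Rightarrow> 'a real_closure" is inverse
proof -
  fix x :: "'a alg_closure"
  assume "x \<in> max_cone \<or> - x \<in> max_cone"
  then show "inverse x \<in> max_cone \<or> - inverse x \<in> max_cone"
    using max_cone_inverse[of x] max_cone_inverse[of "- x"] by auto
qed
definition divide_real_closure :: "'a real_closure \<Rightarrow> 'a real_closure \<Rightarrow> 'a real_closure" where
  "divide_real_closure x y = x * inverse y"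

instance
  by (standard; (simp add: divide_real_closure_def)?; transfer; simp add: algebra_simps)

end

instantiation real_closure :: (linordered_field) linordered_field
begin

lift_definition less_eq_real_closure :: "'a real_closure \<Rightarrow> 'a real_closure \<Rightarrow> bool"
  is "\<lambda>x y. y - x \<in> max_cone" .
definition less_real_closure :: "'a real_closure \<Rightarrow> 'a real_closure \<Rightarrow> bool" where
  "less_real_closure x y \<longleftrightarrow> x \<le> y \<and> x \<noteq> y"
definition abs_real_closure :: "'a real_closure \<Rightarrow> 'a real_closure" where
  "abs_real_closure x = (if x < 0 then - x else x)"
definition sgn_real_closure :: "'a real_closure \<Rightarrow> 'a real_closure" where
  "sgn_real_closure x = (if x = 0 then 0 else if 0 < x then 1 else - 1)"

instance
proof
  fix x y z :: "'a real_closure"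
  show refl: "x \<le> x" by transfer (simp add: max_cone_0)
  show antisym: "x \<le> y \<Longrightarrow> y \<le> x \<Longrightarrow> x = y" for x y :: "'a real_closure"
  proof transfer
    fix x y :: "'a alg_closure"
    assume "y - x \<in> max_cone" "x - y \<in> max_cone"
    then have "y - x = 0" by (intro max_cone_antisym) simp_all
    then show "x = y" by simp
  qed
  show "(x < y) = (x \<le> y \<and> \<not> y \<le> x)"
    using refl antisym by (auto simp: less_real_closure_def)
  show "x \<le> y \<Longrightarrow> y \<le> z \<Longrightarrow> x \<le> z"
  proof transfer
    fix x y z :: "'a alg_closure"
    assume "y - x \<in> max_cone" "z - y \<in> max_cone"
    then show "z - x \<in> max_cone" using max_cone_add[of "y - x" "z - y"] by simp
  qed
  have "0 \<le> x \<or> 0 \<le> - x" for x :: "'a real_closure" by transfer simp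
  from this[of "y - x"] show "x \<le> y \<or> y \<le> x" by (simp add: less_eq_real_closure.rep_eq zero_real_closure.rep_eq minus_real_closure.rep_eq uminus_real_closure.rep_eq)
  show "x \<le> y \<Longrightarrow> z + x \<le> z + y" by transfer simp
  show "x < y \<Longrightarrow> 0 < z \<Longrightarrow> z * x < z * y"
  proof -
    assume xy: "x < y" "0 < z"
    then have "x \<noteq> y" "z \<noteq> 0" by (auto simp: less_real_closure_def)
    then have "z * x \<noteq> z * y" by simp
    moreover have "z * x \<le> z * y"
    proof -
      have "x \<le> y" "0 \<le> z" using xy by (auto simp: less_real_closure_def)
      then show ?thesis
      proof transfer
        fix x y z :: "'a alg_closure"
        assume "y - x \<in> max_cone" "z - 0 \<in> max_cone"
        then show "z * y - z * x \<in> max_cone"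
          using max_cone_mult[of z "y - x"] by (simp add: algebra_simps)
      qed
    qed
    ultimately show ?thesis by (simp add: less_real_closure_def)
  qed
  show "\<bar>x\<bar> = (if x < 0 then - x else x)" by (rule abs_real_closure_def)
  show "sgn x = (if x = 0 then 0 else if 0 < x then 1 else - 1)" by (rule sgn_real_closure_def)
qed

end

lift_definition of_base :: "'a::linordered_field \<Rightarrow> 'a real_closure" is to_ac
proof -
  fix c :: 'a
  show "to_ac c \<in> max_cone \<or> - to_ac c \<in> max_cone"
    using max_cone_of_nonneg[of c] max_cone_of_nonneg[of "- c"] by (cases "0 \<le> c") auto
qed

lemma is_ring_hom_of_base: "is_ring_hom of_base"
  unfolding is_ring_hom_def by (intro conjI allI; transfer; simp)

lemma same_sign_of_base: "same_sign (of_base c) c"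
proof -
  have nonneg: "0 \<le> of_base c" if "0 \<le> c" for c :: 'a
    using that by transfer (simp add: max_cone_of_nonneg)
  have zero: "of_base c = 0 \<longleftrightarrow> c = 0" for c :: 'a by transfer simp
  have "of_base (- c) = - of_base c" by (rule is_ring_homD[OF is_ring_hom_of_base])
  then show ?thesis
    using nonneg[of c] nonneg[of "- c"] zero[of c] by (cases c "0 :: 'a" rule: linorder_cases) (auto simp: same_sign_def)
qed

text \<open>
  The preordering of polynomials generated by the nonnegative constants. It must be kept as sums with a single
  square in each term, since reducing the squares modulo a polynomial then bounds the degree.
\<close>
inductive_set nonneg_sum_squares :: "'a::linordered_field poly set" where
  zero: "0 \<in> nonneg_sum_squares"
| step: "0 \<le> c \<Longrightarrow> t \<in> nonneg_sum_squares \<Longrightarrow> smult c (q * q) + t \<in> nonneg_sum_squares"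

lemma nonneg_sum_squares_add:
  "s \<in> nonneg_sum_squares \<Longrightarrow> t \<in> nonneg_sum_squares \<Longrightarrow> s + t \<in> nonneg_sum_squares"
  by (induction rule: nonneg_sum_squares.induct) (simp_all add: add.assoc nonneg_sum_squares.step)

lemma nonneg_sum_squares_mult:
  assumes "s \<in> nonneg_sum_squares" "t \<in> nonneg_sum_squares"
  shows "s * t \<in> nonneg_sum_squares"
  using assms(1)
proof induction
  case zero
  then show ?case by (simp add: nonneg_sum_squares.zero)
next
  case (step c s q)
  have "smult c (q * q) * t \<in> nonneg_sum_squares"
    using assms(2)
  proof induction
    case zero
    then show ?case by (simp add: nonneg_sum_squares.zero)
  next
    case (step d t r)
    have "smult c (q * q) * (smult d (r * r) + t) = smult (c * d) ((q * r) * (q * r)) + smult c (q * q) * t"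
      by (simp add: algebra_simps)
    then show ?case using step \<open>0 \<le> c\<close> by (simp only: nonneg_sum_squares.step mult_nonneg_nonneg)
  qed
  then show ?case using step.IH by (simp add: distrib_right nonneg_sum_squares_add)
qed

lemma is_ring_hom_Rep: "is_ring_hom Rep_real_closure"
  by (simp add: is_ring_hom_def one_real_closure.rep_eq plus_real_closure.rep_eq times_real_closure.rep_eq)

lemma Rep_real_closure_cone: "x \<in> max_cone \<longleftrightarrow> (\<exists>y \<ge> 0. x = Rep_real_closure y)"
proof
  assume x: "x \<in> max_cone"
  then have "x = Rep_real_closure (Abs_real_closure x)" by (simp add: Abs_real_closure_inverse)
  moreover from this x have "0 \<le> Abs_real_closure x"
    by (simp add: less_eq_real_closure.rep_eq zero_real_closure.rep_eq)
  ultimately show "\<exists>y \<ge> 0. x = Rep_real_closure y" by blast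
next
  assume "\<exists>y \<ge> 0. x = Rep_real_closure y"
  then show "x \<in> max_cone" by (auto simp: less_eq_real_closure.rep_eq zero_real_closure.rep_eq)
qed

text \<open>
  A polynomial \<open>m\<close> of minimal degree with root \<open>\<theta>\<close>: the values \<open>q(\<theta>)\<close> form the simple extension
  of the real closure by \<open>\<theta>\<close>.
\<close>
locale minimal_root =
  fixes \<theta> :: "'a::linordered_field alg_closure" and m :: "'a real_closure poly"
  assumes nz: "m \<noteq> 0"
    and root: "poly (map_poly Rep_real_closure m) \<theta> = 0"
    and minimal: "\<And>q. q \<noteq> 0 \<Longrightarrow> poly (map_poly Rep_real_closure q) \<theta> = 0 \<Longrightarrow> degree m \<le> degree q"
begin

definition val :: "'a real_closure poly \<Rightarrow> 'a alg_closure" where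
  "val q = poly (map_poly Rep_real_closure q) \<theta>"

lemma val_hom: "is_ring_hom val"
  unfolding is_ring_hom_def val_def
  by (simp add: map_poly_hom[OF is_ring_hom_Rep] is_ring_homD[OF is_ring_hom_Rep])

lemma val_const: "val [:c:] = Rep_real_closure c"
  by (simp add: val_def map_poly_pCons zero_real_closure.rep_eq)

lemma val_smult: "val (smult c q) = Rep_real_closure c * val q"
  by (simp add: val_def map_poly_hom[OF is_ring_hom_Rep])

lemma val_mod: "val (q mod m) = val q"
proof -
  have "val q = val (q div m) * val m + val (q mod m)"
    by (metis div_mult_mod_eq is_ring_homD(2,3)[OF val_hom])
  then show ?thesis using root by (simp add: val_def)
qed

lemma degree_pos: "0 < degree m"
proof (rule ccontr)
  assume "\<not> 0 < degree m"
  then obtain c where c: "m = [:c:]" by (metis degree_eq_zeroE gr0I)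
  then have "Rep_real_closure c = 0" using root by (simp add: val_const[symmetric] val_def)
  then have "c = 0" by (metis Rep_real_closure_inject zero_real_closure.rep_eq)
  then show False using nz c by simp
qed

lemma degree_mod: "degree (q mod m) < degree m"
  using degree_pos nz by (metis degree_mod_less degree_0)

lemma val_eq_0_low: "val q = 0 \<Longrightarrow> degree q < degree m \<Longrightarrow> q = 0"
  using minimal[of q] unfolding val_def by fastforce

lemma val_eq_0_dvd:
  assumes "val q = 0"
  shows "m dvd q"
proof -
  have "q mod m = 0" using val_eq_0_low[of "q mod m"] val_mod degree_mod assms by simp
  then show ?thesis by (simp add: mod_eq_0_iff_dvd)
qed

text \<open>
  Take a polynomial \<open>s\<close> of least degree among those with nonzero value in the ideal generated by \<open>q(\<theta>)\<close>.
  Division of \<open>m\<close> by \<open>s\<close> leaves a remainder of smaller degree in this ideal, whose value is therefore zero, so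
  \<open>s\<close> divides \<open>m\<close>; by minimality of \<open>m\<close> it is constant.
\<close>
lemma val_inverse:
  assumes "val q \<noteq> 0"
  shows "\<exists>u. val q * val u = 1"
proof -
  define N where "N = (\<lambda>s. val s \<noteq> 0 \<and> (\<exists>v. val s = val q * val v))"
  have "N q" using assms is_ring_homD(1)[OF val_hom] by (auto simp: N_def intro: exI[of _ 1])
  then obtain s where s: "N s" "\<And>t. N t \<Longrightarrow> degree s \<le> degree t"
    using ex_has_least_nat[of N q degree] by blast
  obtain v where v: "val s = val q * val v" and "val s \<noteq> 0" using s(1) by (auto simp: N_def)
  have "N (s mod m)" using s(1) by (simp add: N_def val_mod)
  then have "degree s < degree m" using s(2) degree_mod by (meson le_less_trans)
  have "degree s = 0"
  proof (rule ccontr)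
    assume "degree s \<noteq> 0"
    define r where "r = m mod s"
    have "s \<noteq> 0" using \<open>degree s \<noteq> 0\<close> by auto
    have "degree r < degree s"
      unfolding r_def using \<open>s \<noteq> 0\<close> \<open>degree s \<noteq> 0\<close> by (metis degree_0 degree_mod_less gr0I)
    have "m = m div s * s + r" by (simp add: r_def)
    then have "val m = val (m div s) * val s + val r"
      by (metis is_ring_homD(2,3)[OF val_hom])
    moreover have "val m = 0" using root by (simp add: val_def)
    ultimately have "val r = - (val (m div s) * (val q * val v))" using v by (simp add: eq_neg_iff_add_eq_0 add.commute)
    also have "\<dots> = val q * val (- (m div s * v))" by (simp add: is_ring_homD(3,5)[OF val_hom] mult_ac)
    finally have "val r = val q * val (- (m div s * v))" .
    then have "val r = 0" using s(2)[of r] \<open>degree r < degree s\<close> by (auto simp: N_def)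
    then have "r = 0" using val_eq_0_low \<open>degree r < degree s\<close> \<open>degree s < degree m\<close> by simp
    then have m: "m = m div s * s" by (metis add.right_neutral div_mult_mod_eq r_def)
    then have "val (m div s) * val s = 0"
      using root by (metis is_ring_homD(3)[OF val_hom] val_def)
    then have "val (m div s) = 0" using \<open>val s \<noteq> 0\<close> by simp
    moreover have "m div s \<noteq> 0" using m nz by auto
    moreover have "degree (m div s) < degree m"
      using m \<open>degree s \<noteq> 0\<close> \<open>m div s \<noteq> 0\<close> \<open>s \<noteq> 0\<close> by (metis degree_mult_eq less_add_same_cancel1 gr0I)
    ultimately show False using val_eq_0_low by blast
  qed
  then obtain k where k: "s = [:k:]" by (metis degree_eq_zeroE)
  have "k \<noteq> 0" using \<open>val s \<noteq> 0\<close> k by (auto simp: is_ring_homD[OF val_hom])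
  have "val q * val (smult (inverse k) v) = Rep_real_closure (inverse k) * val s"
    by (simp add: val_smult v)
  also have "\<dots> = Rep_real_closure (inverse k * k)"
    by (simp add: k val_const times_real_closure.rep_eq)
  finally show ?thesis using \<open>k \<noteq> 0\<close> by (auto simp: one_real_closure.rep_eq)
qed

lemma nonneg_sum_squares_reduce:
  assumes "t \<in> nonneg_sum_squares"
  shows "\<exists>t'. val t' = val t \<and> degree t' \<le> 2 * (degree m - 1) \<and> (\<forall>x. 0 \<le> poly t' x)"
  using assms
proof induction
  case zero
  then show ?case by (intro exI[of _ 0]) auto
next
  case (step c t q)
  then obtain t' where t': "val t' = val t" "degree t' \<le> 2 * (degree m - 1)" "\<forall>x. 0 \<le> poly t' x" by blast
  let ?s = "smult c ((q mod m) * (q mod m)) + t'"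
  have "val ?s = val (smult c (q * q) + t)"
    by (simp add: is_ring_homD[OF val_hom] val_smult val_mod t')
  moreover have "degree ((q mod m) * (q mod m)) \<le> 2 * (degree m - 1)"
    using degree_mult_le[of "q mod m" "q mod m"] degree_mod[of q] by simp
  then have "degree ?s \<le> 2 * (degree m - 1)"
    using t'(2) by (intro degree_add_le) (auto intro: order_trans[OF degree_smult_le])
  moreover have "\<forall>x. 0 \<le> poly ?s x" using t'(3) \<open>0 \<le> c\<close> by simp
  ultimately show ?case by blast
qed

text \<open>
  If \<open>- 1\<close> is a sum of squares in the extension, then modulo \<open>m\<close> the representing polynomials have degree less than
  that of \<open>m\<close>, so \<open>1 + t' = m r\<close> with \<open>r\<close> of degree at most \<open>deg m - 2\<close>.
\<close>
lemma one_plus_nonneg_eq_multiple: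
  assumes "t \<in> nonneg_sum_squares" "val t = - 1"
  shows "\<exists>r t'. degree r < degree m \<and> 1 + t' = m * r \<and> (\<forall>x. 0 \<le> poly t' x)"
proof -
  obtain t' where t': "val t' = - 1" "degree t' \<le> 2 * (degree m - 1)" "\<forall>x. 0 \<le> poly t' x"
    using nonneg_sum_squares_reduce[OF assms(1)] assms(2) by auto
  have "val (1 + t') = 0" using t'(1) by (simp add: is_ring_homD[OF val_hom])
  then obtain r where r: "1 + t' = m * r" using val_eq_0_dvd by (metis dvdE)
  have "poly (1 + t') 0 > 0" using t'(3) by (simp add: add_pos_nonneg)
  then have "r \<noteq> 0" using r by auto
  then have "degree m + degree r = degree (1 + t')" using r nz by (simp add: degree_mult_eq)
  also have "\<dots> \<le> 2 * (degree m - 1)" using t'(2) by (intro degree_add_le) auto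
  finally have "degree r < degree m" using degree_pos by linarith
  then show ?thesis using r t'(3) by blast
qed

text \<open>
  Otherwise the ordering would extend to the simple extension by \<open>\<theta>\<close>, which is a proper extension because the degree of \<open>m\<close>
  exceeds 1. This contradicts the maximality of the ordered subfield.
\<close>
lemma minus_one_is_value_of_sum_squares:
  assumes "1 < degree m"
  shows "\<exists>t\<in>nonneg_sum_squares. val t = - 1"
proof (rule ccontr)
  assume neg: "\<not> ?thesis"
  have B: "is_subring (range val)"
    unfolding is_subring_def
  proof (intro conjI ballI)
    show "1 \<in> range val" by (rule range_eqI[of _ _ 1]) (simp add: is_ring_homD(1)[OF val_hom])
    fix x y assume "x \<in> range val" "y \<in> range val"
    then obtain p q where "x = val p" "y = val q" by blast
    then have "x + y = val (p + q)" "x - y = val (p - q)" "x * y = val (p * q)"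
      by (simp_all add: is_ring_homD(2,3,6)[OF val_hom])
    then show "x + y \<in> range val" "x - y \<in> range val" "x * y \<in> range val" by blast+
  qed
  have T: "ring_preordering (range val) (val ` nonneg_sum_squares)"
    unfolding ring_preordering_def
  proof (intro conjI ballI)
    fix x assume "x \<in> range val"
    then obtain q where "x = val q" by blast
    moreover have "q * q \<in> nonneg_sum_squares"
      using nonneg_sum_squares.step[OF _ nonneg_sum_squares.zero, of 1 q] by simp
    ultimately show "x * x \<in> val ` nonneg_sum_squares"
      using is_ring_homD(3)[OF val_hom] by (metis imageI)
  next
    fix x y assume "x \<in> val ` nonneg_sum_squares" "y \<in> val ` nonneg_sum_squares"
    then obtain s t where st: "s \<in> nonneg_sum_squares" "t \<in> nonneg_sum_squares" "x = val s" "y = val t"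
      by blast
    then have "x + y = val (s + t)" "x * y = val (s * t)" by (simp_all add: is_ring_homD(2,3)[OF val_hom])
    then show "x + y \<in> val ` nonneg_sum_squares" "x * y \<in> val ` nonneg_sum_squares"
      using nonneg_sum_squares_add[OF st(1,2)] nonneg_sum_squares_mult[OF st(1,2)] by blast+
  qed auto
  have cone: "max_cone \<subseteq> val ` nonneg_sum_squares"
  proof
    fix x :: "'a alg_closure" assume "x \<in> max_cone"
    then obtain c where c: "0 \<le> c" "x = Rep_real_closure c" by (auto simp: Rep_real_closure_cone)
    have "[:c:] \<in> nonneg_sum_squares"
      using nonneg_sum_squares.step[OF c(1) nonneg_sum_squares.zero, of 1] by simp
    then show "x \<in> val ` nonneg_sum_squares" using c(2) val_const by (metis imageI)
  qed
  obtain P where P: "val ` nonneg_sum_squares \<subseteq> P" "ring_preordering (range val) P" "- 1 \<notin> P"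
    "\<And>x. x \<in> range val \<Longrightarrow> x \<in> P \<or> - x \<in> P"
    using ring_preordering_extends_to_ordering[OF B T] neg by (metis imageE)
  have PB: "P \<subseteq> range val" and sq: "\<And>x. x \<in> range val \<Longrightarrow> x * x \<in> P"
    and cl: "\<And>x y. x \<in> P \<Longrightarrow> y \<in> P \<Longrightarrow> x + y \<in> P" "\<And>x y. x \<in> P \<Longrightarrow> y \<in> P \<Longrightarrow> x * y \<in> P"
    using P(2) by (auto simp: ring_preordering_def)
  have "inverse x \<in> P" if xP: "x \<in> P" for x
  proof (cases "x = 0")
    case False
    obtain q where q: "x = val q" using xP PB by blast
    then obtain u where "x * val u = 1" using val_inverse False by metis
    then have "inverse x = val u" by (simp add: inverse_unique)
    then have "inverse x * inverse x \<in> P" using sq by simp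
    then have "x * (inverse x * inverse x) \<in> P" using cl xP by blast
    moreover have "x * (inverse x * inverse x) = inverse x" using False by simp
    ultimately show ?thesis by simp
  qed (use xP in simp)
  moreover have "x - y \<in> P \<or> y - x \<in> P" if "x \<in> P" "y \<in> P" for x y
  proof -
    have "x - y \<in> range val" using B that PB unfolding is_subring_def by blast
    then show ?thesis using P(4) by (metis minus_diff_eq)
  qed
  moreover have "to_ac ` {0..} \<subseteq> P" using max_cone_of_nonneg cone P(1) by (metis atLeast_iff image_subsetI subsetD)
  ultimately have "field_cone P" using P(3) cl by (simp add: field_cone_def)
  then have "P = max_cone" using max_cone_maximal cone P(1) by blast
  moreover have "val [:0, 1:] = \<theta>"
    by (simp add: val_def map_poly_pCons zero_real_closure.rep_eq one_real_closure.rep_eq)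
  ultimately have "\<theta> \<in> max_cone \<or> - \<theta> \<in> max_cone" using P(4) by (metis rangeI)
  then have "Rep_real_closure (Abs_real_closure \<theta>) = \<theta>" by (simp add: Abs_real_closure_inverse)
  then obtain c where c: "Rep_real_closure c = \<theta>" by blast
  have "val [:- c, 1:] = \<theta> - Rep_real_closure c"
    by (simp add: val_def map_poly_pCons zero_real_closure.rep_eq one_real_closure.rep_eq uminus_real_closure.rep_eq)
  then have "val [:- c, 1:] = 0" using c by simp
  then have "[:- c, 1:] = 0" using assms by (intro val_eq_0_low) simp_all
  then show False by simp
qed

end

lemma linear_sign_change_root:
  fixes p :: "'a::linordered_field poly"
  assumes "degree p = 1" "a < b" "poly p a * poly p b < 0"
  shows "\<exists>c. a < c \<and> c < b \<and> poly p c = 0"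
proof -
  obtain u q where q: "p = pCons u q" by (cases p)
  then have "degree q = 0" "q \<noteq> 0" using assms(1) by (auto split: if_splits)
  then obtain v where "q = [:v:]" "v \<noteq> 0" by (metis degree_eq_zeroE pCons_0_0)
  then have p: "p = [:u, v:]" using q by simp
  define c where "c = - u / v"
  have px: "poly p x = v * (x - c)" for x using \<open>v \<noteq> 0\<close> by (simp add: p c_def field_simps)
  have "v * v * ((a - c) * (b - c)) < 0" using assms(3) by (simp add: px algebra_simps)
  moreover have "0 < v * v" using \<open>v \<noteq> 0\<close> by (auto simp: zero_less_mult_iff)
  ultimately have "(a - c) * (b - c) < 0" by (simp only: mult_less_0_iff[of "v * v"]) auto
  then have "a < c" "c < b" using assms(2) by (auto simp: mult_less_0_iff)
  then show ?thesis using px by auto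
qed

text \<open>
  By induction on the degree, following the proof that an irreducible polynomial with a sign change defines an orderable
  extension. Let \<open>m\<close> be the minimal polynomial of a root of \<open>p\<close> in the algebraic closure. Either a proper factor of \<open>p\<close> changes
  sign, or \<open>m\<close> does and has the degree of \<open>p\<close>. If \<open>m\<close> is not linear, then \<open>m r = 1 + t'\<close> with \<open>t' \<ge> 0\<close> everywhere,
  so \<open>r\<close> changes sign together with \<open>m\<close>. But then \<open>r\<close>, having smaller degree, has a root, and \<open>1 + t'\<close> would vanish there.
\<close>
lemma real_closure_sign_change_root:
  fixes p :: "'a::linordered_field real_closure poly"
  assumes "a < b" "poly p a * poly p b < 0"
  shows "\<exists>c. a < c \<and> c < b \<and> poly p c = 0"
  using assms(2)
proof (induction "degree p" arbitrary: p rule: less_induct)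
  case less
  have "p \<noteq> 0" using less.prems by auto
  have "0 < degree p"
  proof (rule ccontr)
    assume "\<not> 0 < degree p"
    then obtain c where "p = [:c:]" by (metis degree_eq_zeroE gr0I)
    then show False using less.prems by (simp add: not_less[symmetric])
  qed
  moreover have "degree (map_poly Rep_real_closure p) = degree p"
    by (rule degree_map_poly) (metis Rep_real_closure_inject zero_real_closure.rep_eq)
  ultimately obtain \<theta> where \<theta>: "poly (map_poly Rep_real_closure p) \<theta> = 0"
    using alg_closed_imp_poly_has_root by metis
  define N where "N = (\<lambda>q. q \<noteq> 0 \<and> poly (map_poly Rep_real_closure q) \<theta> = 0)"
  have "N p" using \<theta> \<open>p \<noteq> 0\<close> by (simp add: N_def)
  then obtain m where m: "N m" "\<And>q. N q \<Longrightarrow> degree m \<le> degree q"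
    using ex_has_least_nat[of N p degree] by blast
  interpret minimal_root \<theta> m
    using m by unfold_locales (auto simp: N_def)
  obtain u where u: "p = m * u"
    using val_eq_0_dvd[of p] \<theta> by (auto simp: val_def)
  have "u \<noteq> 0" using u \<open>p \<noteq> 0\<close> by auto
  then have deg: "degree p = degree m + degree u" using nz u by (simp add: degree_mult_eq)
  have "(poly m a * poly m b) * (poly u a * poly u b) < 0"
    using less.prems by (simp add: u algebra_simps)
  then consider "poly u a * poly u b < 0" | "poly m a * poly m b < 0"
    by (auto simp: mult_less_0_iff[of "poly m a * poly m b"])
  then show ?case
  proof cases
    case 1
    then show ?thesis using less.hyps[of u] deg degree_pos u by auto
  next
    case 2
    have "\<exists>c. a < c \<and> c < b \<and> poly m c = 0"
    proof (cases "degree m = 1")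
      case True
      then show ?thesis using linear_sign_change_root \<open>a < b\<close> 2 by blast
    next
      case False
      then obtain t where "t \<in> nonneg_sum_squares" "val t = - 1"
        using minus_one_is_value_of_sum_squares degree_pos by (metis One_nat_def Suc_lessI)
      then obtain r t' where r: "degree r < degree m" "1 + t' = m * r" "\<forall>x. 0 \<le> poly t' x"
        using one_plus_nonneg_eq_multiple by blast
      have pos: "0 < poly m x * poly r x" for x
        using r(3) arg_cong[OF r(2), of "\<lambda>q. poly q x"] by (metis add_pos_nonneg poly_1 poly_add poly_mult zero_less_one)
      have "0 < (poly m a * poly m b) * (poly r a * poly r b)"
        using mult_pos_pos[OF pos[of a] pos[of b]] by (simp add: mult_ac)
      then have "poly r a * poly r b < 0"
        unfolding zero_less_mult_iff[of "poly m a * poly m b"] using 2 less_asym by blast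
      then obtain c where "poly r c = 0" using less.hyps[of r] r(1) deg by auto
      then show ?thesis using pos[of c] by simp
    qed
    then show ?thesis using u by auto
  qed
qed

instance real_closure :: (linordered_field) real_closed_field
proof
  fix f :: "nat \<Rightarrow> 'a real_closure" and n a b
  assume ab: "a < b" "(\<Sum>k\<le>n. f k * a ^ k) < 0" "0 < (\<Sum>k\<le>n. f k * b ^ k)"
  define p where "p = (\<Sum>k\<le>n. monom (f k) k)"
  have "poly p x = (\<Sum>k\<le>n. f k * x ^ k)" for x by (simp add: p_def poly_sum poly_monom)
  then show "\<exists>c>a. c < b \<and> (\<Sum>k\<le>n. f k * c ^ k) = 0"
    using real_closure_sign_change_root[of a b p] ab by (simp add: mult_neg_pos)
qed

section \<open>From points over a real closed field to real points\<close>

lemma rpoly_eq_sum_single: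
  fixes p :: "'n rpoly"
  shows "p = (\<Sum>m\<in>Poly_Mapping.keys p. Poly_Mapping.single m (Poly_Mapping.lookup p m))"
  by (rule poly_mapping_eqI) (auto simp: lookup_sum lookup_single when_def in_keys_iff)

definition eval_monomial :: "('n::finite, nat) poly_mapping \<Rightarrow> real ^ 'n \<Rightarrow> real" where
  "eval_monomial m x = (\<Prod>i\<in>UNIV. (x $ i) ^ Poly_Mapping.lookup m i)"

lemma eval_monomial_add: "eval_monomial (m + m') x = eval_monomial m x * eval_monomial m' x"
  by (simp add: eval_monomial_def lookup_add power_add prod.distrib)

lemma eval_poly_superset:
  assumes "finite A" "Poly_Mapping.keys p \<subseteq> A"
  shows "eval_poly p x = (\<Sum>m\<in>A. Poly_Mapping.lookup p m * eval_monomial m x)"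
  unfolding eval_poly_def eval_monomial_def
  using assms by (intro sum.mono_neutral_left) (auto simp: in_keys_iff)

lemma eval_poly_add: "eval_poly (p + q) x = eval_poly p x + eval_poly q x"
proof -
  let ?A = "Poly_Mapping.keys p \<union> Poly_Mapping.keys q"
  have "eval_poly (p + q) x = (\<Sum>m\<in>?A. Poly_Mapping.lookup (p + q) m * eval_monomial m x)"
    by (rule eval_poly_superset) (simp_all add: Poly_Mapping.keys_add)
  also have "\<dots> = (\<Sum>m\<in>?A. Poly_Mapping.lookup p m * eval_monomial m x) + (\<Sum>m\<in>?A. Poly_Mapping.lookup q m * eval_monomial m x)"
    by (simp add: lookup_add distrib_right sum.distrib)
  also have "\<dots> = eval_poly p x + eval_poly q x"
    by (simp add: eval_poly_superset[of ?A p] eval_poly_superset[of ?A q])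
  finally show ?thesis .
qed

lemma eval_poly_0 [simp]: "eval_poly 0 x = 0"
  by (simp add: eval_poly_def)

lemma eval_poly_sum: "eval_poly (sum f A) x = (\<Sum>i\<in>A. eval_poly (f i) x)"
  by (induction A rule: infinite_finite_induct) (simp_all add: eval_poly_add)

lemma eval_poly_single: "eval_poly (Poly_Mapping.single m c) x = c * eval_monomial m x"
  by (cases "c = 0") (simp_all add: eval_poly_def eval_monomial_def)

lemma eval_poly_mult: "eval_poly (p * q) x = eval_poly p x * eval_poly q x"
proof -
  have "p * q = (\<Sum>m\<in>Poly_Mapping.keys p. Poly_Mapping.single m (Poly_Mapping.lookup p m)) *
      (\<Sum>m\<in>Poly_Mapping.keys q. Poly_Mapping.single m (Poly_Mapping.lookup q m))"
    by (rule arg_cong2[where f = "(*)"]) (rule rpoly_eq_sum_single)+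
  also have "\<dots> = (\<Sum>m\<in>Poly_Mapping.keys p. \<Sum>m'\<in>Poly_Mapping.keys q.
      Poly_Mapping.single (m + m') (Poly_Mapping.lookup p m * Poly_Mapping.lookup q m'))"
    by (simp add: sum_product mult_single)
  finally have "eval_poly (p * q) x = (\<Sum>m\<in>Poly_Mapping.keys p. \<Sum>m'\<in>Poly_Mapping.keys q.
      (Poly_Mapping.lookup p m * eval_monomial m x) * (Poly_Mapping.lookup q m' * eval_monomial m' x))"
    by (simp add: eval_poly_sum eval_poly_single eval_monomial_add mult_ac)
  then show ?thesis by (simp add: sum_product eval_poly_def eval_monomial_def)
qed

lemma eval_poly_const_poly [simp]: "eval_poly (const_poly c) x = c"
  by (simp add: const_poly_def eval_poly_single eval_monomial_def)

lemma const_poly_1: "const_poly 1 = 1"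
  by (simp add: const_poly_def)

lemma is_ring_hom_eval_poly: "is_ring_hom (\<lambda>p. eval_poly p x)"
  unfolding is_ring_hom_def using eval_poly_const_poly[of 1 x]
  by (simp add: eval_poly_add eval_poly_mult const_poly_1)

lemma is_ring_hom_const_poly: "is_ring_hom const_poly"
  by (simp add: is_ring_hom_def const_poly_def single_add mult_single)

definition variable :: "'n \<Rightarrow> 'n rpoly" where
  "variable i = Poly_Mapping.single (Poly_Mapping.single i 1) 1"

lemma variable_power: "variable i ^ k = Poly_Mapping.single (Poly_Mapping.single i k) 1"
  by (induction k) (simp_all add: variable_def mult_single single_add[symmetric])

lemma eval_poly_variable [simp]: "eval_poly (variable i) x = x $ i"
proof -
  have "(\<Prod>j\<in>UNIV. (x $ j) ^ Poly_Mapping.lookup (Poly_Mapping.single i 1) j) = (\<Prod>j\<in>UNIV. if j = i then x $ i else 1)"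
    by (rule prod.cong) (auto simp: lookup_single when_def)
  also have "\<dots> = x $ i" by simp
  finally show ?thesis by (simp add: variable_def eval_poly_single eval_monomial_def)
qed

text \<open>
  The polynomials in the variables from \<open>J\<close>, as a subring of the ring in all variables. Keeping one ring type
  makes induction on the number of variables possible.
\<close>
definition polys_in :: "'n set \<Rightarrow> 'n rpoly set" where
  "polys_in J = {p. \<forall>m\<in>Poly_Mapping.keys p. Poly_Mapping.keys m \<subseteq> J}"

lemma polys_in_UNIV [simp]: "polys_in UNIV = UNIV"
  by (simp add: polys_in_def)

lemma is_subring_polys_in:
  fixes J :: "'n set"
  shows "is_subring (polys_in J)"
proof -
  have keys_add_nat: "Poly_Mapping.keys (m + m') = Poly_Mapping.keys m \<union> Poly_Mapping.keys m'" for m m' :: "('n, nat) poly_mapping"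
    by (auto simp: in_keys_iff lookup_add)
  have "p * q \<in> polys_in J" if "p \<in> polys_in J" "q \<in> polys_in J" for p q :: "'n rpoly"
    using that keys_mult[of p q] unfolding polys_in_def by (fastforce simp: keys_add_nat)
  moreover have "p + q \<in> polys_in J" if "p \<in> polys_in J" "q \<in> polys_in J" for p q :: "'n rpoly"
    using that Poly_Mapping.keys_add[of p q] unfolding polys_in_def by blast
  moreover have "p - q \<in> polys_in J" if "p \<in> polys_in J" "q \<in> polys_in J" for p q :: "'n rpoly"
  proof -
    have "Poly_Mapping.keys (p - q) \<subseteq> Poly_Mapping.keys p \<union> Poly_Mapping.keys q"
      by (auto simp: in_keys_iff lookup_minus)
    then show ?thesis using that unfolding polys_in_def by blast
  qed
  moreover have "1 \<in> polys_in J" by (simp add: polys_in_def)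
  ultimately show ?thesis by (simp add: is_subring_def)
qed

lemma eval_poly_cong_polys_in:
  assumes "p \<in> polys_in J" "\<And>j. j \<in> J \<Longrightarrow> x $ j = y $ j"
  shows "eval_poly p x = eval_poly p y"
proof -
  have "x $ i ^ Poly_Mapping.lookup m i = y $ i ^ Poly_Mapping.lookup m i"
    if "m \<in> Poly_Mapping.keys p" for m i
  proof (cases "i \<in> J")
    case False
    then have "i \<notin> Poly_Mapping.keys m" using assms(1) that unfolding polys_in_def by blast
    then have "Poly_Mapping.lookup m i = 0" by (simp add: in_keys_iff)
    then show ?thesis by simp
  qed (simp add: assms(2))
  then show ?thesis unfolding eval_poly_def by (intro sum.cong prod.cong refl arg_cong2[of _ _ _ _ "(*)"]) auto
qed

lemma polys_in_insert_as_univariate: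
  fixes p :: "'n rpoly"
  assumes "p \<in> polys_in (insert i J)"
  shows "\<exists>P. (\<forall>k. coeff P k \<in> polys_in J) \<and> poly P (variable i) = p"
proof -
  define rest where "rest = (\<lambda>m :: ('n, nat) poly_mapping. m - Poly_Mapping.single i (Poly_Mapping.lookup m i))"
  define P where "P = (\<Sum>m\<in>Poly_Mapping.keys p.
    monom (Poly_Mapping.single (rest m) (Poly_Mapping.lookup p m)) (Poly_Mapping.lookup m i))"
  have lookup_rest: "Poly_Mapping.lookup (rest m) j = (if j = i then 0 else Poly_Mapping.lookup m j)" for m j
    by (simp add: rest_def lookup_minus lookup_single)
  have rest_add: "rest m + Poly_Mapping.single i (Poly_Mapping.lookup m i) = m" for m
    by (rule poly_mapping_eqI) (auto simp: lookup_add lookup_rest lookup_single)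
  have "poly P (variable i) = (\<Sum>m\<in>Poly_Mapping.keys p. Poly_Mapping.single m (Poly_Mapping.lookup p m))"
    by (simp add: P_def poly_sum poly_monom variable_power mult_single rest_add)
  then have "poly P (variable i) = p" using rpoly_eq_sum_single[of p] by simp
  moreover have "coeff P k \<in> polys_in J" for k
  proof -
    have sum: "sum f A \<in> polys_in J" if "\<And>m. m \<in> A \<Longrightarrow> f m \<in> polys_in J" for f :: "_ \<Rightarrow> 'n rpoly" and A :: "('n, nat) poly_mapping set"
      using that
    proof (induction A rule: infinite_finite_induct)
      case (insert m A)
      then show ?case using is_subring_polys_in[of J] unfolding is_subring_def by (simp add: insert.hyps)
    qed (simp_all add: polys_in_def)
    have "Poly_Mapping.single (rest m) (Poly_Mapping.lookup p m) \<in> polys_in J" if "m \<in> Poly_Mapping.keys p" for m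
    proof -
      have "Poly_Mapping.keys (rest m) \<subseteq> Poly_Mapping.keys m - {i}" by (auto simp: in_keys_iff lookup_rest split: if_splits)
      moreover have "Poly_Mapping.keys m \<subseteq> insert i J" using assms that by (simp add: polys_in_def)
      ultimately have "Poly_Mapping.keys (rest m) \<subseteq> J" by blast
      then show ?thesis by (simp add: polys_in_def)
    qed
    moreover have "0 \<in> polys_in J" by (simp add: polys_in_def)
    ultimately show ?thesis unfolding P_def coeff_sum by (intro sum) (simp add: coeff_monom)
  qed
  ultimately show ?thesis by blast
qed

lemma pseudo_divmod_main_coeffs_in:
  assumes B: "is_subring B" and "lc \<in> B" "\<And>k. coeff r k \<in> B" "\<And>k. coeff d k \<in> B"
  shows "coeff (snd (pseudo_divmod_main lc q r d dr n)) k \<in> B"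
  using assms(3)
proof (induction n arbitrary: q r dr)
  case (Suc n)
  have "coeff (smult lc r - monom (coeff r dr) n * d) k \<in> B" for k
  proof -
    have "0 \<in> B" using B unfolding is_subring_def by (metis cancel_comm_monoid_add_class.diff_cancel)
    then have "coeff (monom (coeff r dr) n * d) k \<in> B"
      using B Suc.prems assms(4) by (auto simp: coeff_monom_mult is_subring_def)
    then show ?thesis using B Suc.prems assms(2) by (auto simp: is_subring_def)
  qed
  then show ?case by (simp add: Let_def Suc.IH)
qed simp

lemma descendants_coeffs_in:
  assumes B: "is_subring B" and U: "U \<subseteq> {p. \<forall>k. coeff p k \<in> B}"
  shows "descendants U \<subseteq> {p. \<forall>k. coeff p k \<in> B}"
proof -
  have one: "1 \<in> B" and cl: "\<And>x y. x \<in> B \<Longrightarrow> y \<in> B \<Longrightarrow> x + y \<in> B" "\<And>x y. x \<in> B \<Longrightarrow> y \<in> B \<Longrightarrow> x * y \<in> B"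
    using B by (auto simp: is_subring_def)
  have zero: "0 \<in> B" using B unfolding is_subring_def by (metis cancel_comm_monoid_add_class.diff_cancel)
  have of_nat: "of_nat k \<in> B" for k by (induction k) (simp_all add: zero one cl)
  have power: "x ^ k \<in> B" if "x \<in> B" for x k using that by (induction k) (simp_all add: one cl)
  have "coeff (formal_deriv p) k \<in> B" "coeff (drop_lead p) k \<in> B" if "p \<in> U" for p k
    using that U cl(2)[OF of_nat] zero by (auto simp: coeff_formal_deriv coeff_drop_lead simp del: of_nat_Suc)
  moreover have "coeff (even_rem p q) k \<in> B" if "p \<in> U" "q \<in> U" for p q k
  proof -
    have pq: "coeff p k \<in> B" "coeff q k \<in> B" for k using that U by auto
    then have "coeff (snd (pseudo_divmod p q)) k \<in> B"
      unfolding pseudo_divmod_def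
      by (auto simp: zero intro: pseudo_divmod_main_coeffs_in[OF B])
    then show ?thesis using pq power cl(2) by (simp add: even_rem_def)
  qed
  ultimately show ?thesis unfolding descendants_def by blast
qed

text \<open>
  A positive real number is a square, and homomorphisms preserve squares and units.
\<close>
lemma hom_const_poly_same_sign:
  fixes \<phi> :: "'n rpoly \<Rightarrow> 'f::real_closed_field"
  assumes "is_ring_hom \<phi>"
  shows "same_sign (\<phi> (const_poly c)) c"
proof -
  note hom = is_ring_homD[OF is_ring_hom_comp[OF is_ring_hom_const_poly assms]]
  have pos: "0 < \<phi> (const_poly c)" if "0 < c" for c
  proof -
    have "\<phi> (const_poly c) = \<phi> (const_poly (sqrt c)) * \<phi> (const_poly (sqrt c))"
      using that by (simp add: hom(3)[symmetric])
    moreover have "\<phi> (const_poly c) * \<phi> (const_poly (inverse c)) = 1"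
      using that by (simp add: hom(3)[symmetric] hom(1))
    then have "\<phi> (const_poly c) \<noteq> 0" by auto
    moreover have "0 \<le> \<phi> (const_poly (sqrt c)) * \<phi> (const_poly (sqrt c))" by (rule zero_le_square)
    ultimately show ?thesis by linarith
  qed
  show ?thesis
    using pos[of c] pos[of "- c"] hom(4) hom(5)[of c] by (cases c "0 :: real" rule: linorder_cases) (auto simp: same_sign_def)
qed

text \<open>
  Induction on the set of variables that occur. To add the variable \<open>i\<close>, regard the polynomials as
  univariate ones over those in \<open>J\<close> and enlarge the family to a closed one. The induction hypothesis finds real values of the variables
  in \<open>J\<close> at which the leading coefficients have the right signs, and the sign diagrams then yield a real value for the variable \<open>i\<close>.
\<close>
theorem hom_sign_transfer:
  fixes \<phi> :: "'n::finite rpoly \<Rightarrow> 'f::real_closed_field"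
  assumes hom: "is_ring_hom \<phi>" and "finite Q"
  shows "\<exists>a. \<forall>q\<in>Q. same_sign (\<phi> q) (eval_poly q a)"
proof -
  have "\<forall>Q. finite Q \<longrightarrow> Q \<subseteq> polys_in J \<longrightarrow> (\<exists>a. \<forall>q\<in>Q. same_sign (\<phi> q) (eval_poly q a))"
    if "finite J" for J
    using that
  proof induction
    case empty
    have "same_sign (\<phi> q) (eval_poly q a)" if "q \<in> polys_in {}" for q a
    proof -
      have "Poly_Mapping.keys q \<subseteq> {0}" using that by (auto simp: polys_in_def)
      then have "q = const_poly (Poly_Mapping.lookup q 0)"
        unfolding const_poly_def
        by (intro poly_mapping_eqI) (auto simp: lookup_single when_def in_keys_iff)
      then show ?thesis using hom_const_poly_same_sign[OF hom] eval_poly_const_poly by metis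
    qed
    then show ?case by blast
  next
    case (insert i J)
    show ?case
    proof (intro allI impI)
      fix Q :: "'n rpoly set" assume Q: "finite Q" "Q \<subseteq> polys_in (insert i J)"
      define S where "S = {P :: 'n rpoly poly. \<forall>k. coeff P k \<in> polys_in J}"
      obtain F where F: "\<And>q. q \<in> Q \<Longrightarrow> F q \<in> S \<and> poly (F q) (variable i) = q"
        using polys_in_insert_as_univariate[of _ i J] Q(2) unfolding S_def mem_Collect_eq by (metis subsetD)
      have "descendants U \<subseteq> S" if "U \<subseteq> S" for U
        using descendants_coeffs_in[OF is_subring_polys_in, of U J] that unfolding S_def by blast
      moreover have "F ` Q \<subseteq> S" "finite (F ` Q)" using F Q(1) by auto
      ultimately obtain U where U: "finite U" "F ` Q \<subseteq> U" "U \<subseteq> S" "descendants U \<subseteq> U"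
        using exists_closed_family[of "F ` Q" S] by blast
      have "finite (lead_coeff ` U)" "lead_coeff ` U \<subseteq> polys_in J" using U by (auto simp: S_def)
      then have "\<exists>a. \<forall>q\<in>lead_coeff ` U. same_sign (\<phi> q) (eval_poly q a)" by (rule insert.IH[rule_format])
      then obtain a where a: "\<And>p. p \<in> U \<Longrightarrow> same_sign (\<phi> (lead_coeff p)) (eval_poly (lead_coeff p) a)"
        by auto
      interpret sign_matching \<phi> "\<lambda>p. eval_poly p a" U
        by unfold_locales (use hom is_ring_hom_eval_poly U a in auto)
      obtain y where y: "matched (\<phi> (variable i)) y" using exists_matched_point by blast
      define b where "b = (\<chi> j. if j = i then y else a $ j)"
      have "same_sign (\<phi> q) (eval_poly q b)" if "q \<in> Q" for q
      proof -
        have "F q \<in> U" using U(2) that by blast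
        then have "same_sign (ev1 (F q) (\<phi> (variable i))) (ev2 (F q) y)" using y by (simp add: matched_def)
        moreover have "ev1 (F q) (\<phi> (variable i)) = \<phi> q"
          using F[OF that] by (simp add: poly_map_poly_hom[OF hom])
        moreover have "map_poly (\<lambda>p. eval_poly p a) (F q) = map_poly (\<lambda>p. eval_poly p b) (F q)"
        proof (rule poly_eqI)
          fix k
          have "coeff (F q) k \<in> polys_in J" using F[OF that] by (simp add: S_def)
          moreover have "a $ j = b $ j" if "j \<in> J" for j using that insert.hyps by (auto simp: b_def)
          ultimately have "eval_poly (coeff (F q) k) a = eval_poly (coeff (F q) k) b"
            by (rule eval_poly_cong_polys_in)
          then show "coeff (map_poly (\<lambda>p. eval_poly p a) (F q)) k = coeff (map_poly (\<lambda>p. eval_poly p b) (F q)) k"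
            by (simp add: coeff_map_poly)
        qed
        then have "ev2 (F q) y = poly (map_poly (\<lambda>p. eval_poly p b) (F q)) (eval_poly (variable i) b)"
          by (simp add: b_def)
        then have "ev2 (F q) y = eval_poly (poly (F q) (variable i)) b"
          by (simp only: poly_map_poly_hom[OF is_ring_hom_eval_poly])
        then have "ev2 (F q) y = eval_poly q b" using F[OF that] by simp
        ultimately show ?thesis by simp
      qed
      then show "\<exists>a. \<forall>q\<in>Q. same_sign (\<phi> q) (eval_poly q a)" by blast
    qed
  qed
  from this[of UNIV] show ?thesis using assms(2) by simp
qed

section \<open>Prime cones of the polynomial ring\<close>

text \<open>
  A point of the real spectrum: an ordering of the residue ring modulo the prime ideal \<open>P \<inter> - P\<close>.
\<close>
definition prime_cone :: "'a::comm_ring_1 set \<Rightarrow> bool" where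
  "prime_cone P \<longleftrightarrow> ring_preordering UNIV P \<and> - 1 \<notin> P \<and> (\<forall>x. x \<in> P \<or> - x \<in> P) \<and>
     (\<forall>x y. x * y \<in> P \<and> - (x * y) \<in> P \<longrightarrow> (x \<in> P \<and> - x \<in> P) \<or> (y \<in> P \<and> - y \<in> P))"

lemma prime_coneD:
  assumes "prime_cone P"
  shows "x \<in> P \<Longrightarrow> y \<in> P \<Longrightarrow> x + y \<in> P" "x \<in> P \<Longrightarrow> y \<in> P \<Longrightarrow> x * y \<in> P" "x * x \<in> P" "- 1 \<notin> P"
    "x \<in> P \<or> - x \<in> P" "x * y \<in> P \<Longrightarrow> - (x * y) \<in> P \<Longrightarrow> (x \<in> P \<and> - x \<in> P) \<or> (y \<in> P \<and> - y \<in> P)"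
    "0 \<in> P" "1 \<in> P"
proof -
  show sq: "x * x \<in> P" for x using assms by (simp add: prime_cone_def ring_preordering_def)
  show "0 \<in> P" "1 \<in> P" using sq[of 0] sq[of 1] by simp_all
qed (use assms in \<open>simp_all add: prime_cone_def ring_preordering_def\<close>)

text \<open>
  In the ordering defined by \<open>P\<close>, an element \<open>q\<close> is positive iff \<open>- q \<notin> P\<close> and negative iff \<open>q \<notin> P\<close>.
\<close>
definition realised :: "'n::finite rpoly set \<Rightarrow> bool" where
  "realised P \<longleftrightarrow> (\<forall>Q. finite Q \<longrightarrow> (\<exists>a. \<forall>q\<in>Q. (0 < eval_poly q a \<longleftrightarrow> - q \<notin> P) \<and> (eval_poly q a < 0 \<longleftrightarrow> q \<notin> P)))"

text \<open>
  The ordered residue ring of a cone has to be a type, and types cannot depend on a variable cone. So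
  the cone is fixed once and for all as a counterexample to the claim that all prime cones are realised, if there is
  one. It is enough to prove that this particular cone is realised.
\<close>
definition suspect_cone :: "'n::finite rpoly set" where
  "suspect_cone = (SOME P. prime_cone P \<and> ((\<exists>P' :: 'n rpoly set. prime_cone P' \<and> \<not> realised P') \<longrightarrow> \<not> realised P))"

lemma
  fixes P' :: "'n::finite rpoly set"
  shows suspect_cone: "prime_cone (suspect_cone :: 'n::finite rpoly set)"
  and not_realised_suspect_cone: "prime_cone P' \<Longrightarrow> \<not> realised P' \<Longrightarrow> \<not> realised (suspect_cone :: 'n::finite rpoly set)"
proof -
  \<comment> \<open>evaluation at the origin shows that there are prime cones at all\<close>
  have "prime_cone {p :: 'n rpoly. 0 \<le> eval_poly p 0}"
    using is_ring_homD[OF is_ring_hom_eval_poly[of "0 :: real ^ 'n"]]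
    by (auto simp: prime_cone_def ring_preordering_def)
  then have "\<exists>P :: 'n rpoly set. prime_cone P \<and> ((\<exists>P' :: 'n rpoly set. prime_cone P' \<and> \<not> realised P') \<longrightarrow> \<not> realised P)"
    by blast
  from someI_ex[OF this]
  have *: "prime_cone (suspect_cone :: 'n rpoly set) \<and>
      ((\<exists>P' :: 'n rpoly set. prime_cone P' \<and> \<not> realised P') \<longrightarrow> \<not> realised (suspect_cone :: 'n rpoly set))"
    unfolding suspect_cone_def .
  then show "prime_cone (suspect_cone :: 'n rpoly set)" by blast
  show "prime_cone P' \<Longrightarrow> \<not> realised P' \<Longrightarrow> \<not> realised (suspect_cone :: 'n rpoly set)"
    using * by blast
qed

definition suspect_rel :: "'n::finite rpoly \<Rightarrow> 'n rpoly \<Rightarrow> bool" where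
  "suspect_rel p q \<longleftrightarrow> p - q \<in> suspect_cone \<and> q - p \<in> suspect_cone"

lemma suspect_rel_add: "suspect_rel p q \<Longrightarrow> suspect_rel p' q' \<Longrightarrow> suspect_rel (p + p') (q + q')"
  unfolding suspect_rel_def
  using prime_coneD(1)[OF suspect_cone, of "p - q" "p' - q'"] prime_coneD(1)[OF suspect_cone, of "q - p" "q' - p'"]
  by (simp add: algebra_simps)

lemma suspect_rel_uminus: "suspect_rel p q \<Longrightarrow> suspect_rel (- p) (- q)"
  by (simp add: suspect_rel_def)

lemma suspect_rel_sym: "suspect_rel p q \<Longrightarrow> suspect_rel q p"
  by (simp add: suspect_rel_def)

lemma suspect_rel_mult_left:
  assumes "suspect_rel p q"
  shows "suspect_rel (r * p) (r * q)"
proof -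
  have "suspect_rel (r * p) (r * q)" if "r \<in> suspect_cone" for r
    using assms prime_coneD(2)[OF suspect_cone that, of "p - q"] prime_coneD(2)[OF suspect_cone that, of "q - p"]
    by (simp add: suspect_rel_def algebra_simps)
  from this[of r] this[of "- r"] prime_coneD(5)[OF suspect_cone, of r] show ?thesis
    using suspect_rel_uminus[of "- r * p" "- r * q"] by auto
qed

lemma equivp_suspect_rel: "equivp (suspect_rel :: 'n::finite rpoly \<Rightarrow> _)"
proof (rule equivpI)
  show "reflp (suspect_rel :: 'n rpoly \<Rightarrow> _)"
    by (rule reflpI) (simp add: suspect_rel_def prime_coneD(7)[OF suspect_cone])
  show "symp (suspect_rel :: 'n rpoly \<Rightarrow> _)"
    by (rule sympI) (rule suspect_rel_sym)
  show "transp (suspect_rel :: 'n rpoly \<Rightarrow> _)"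
  proof (rule transpI)
    fix p q r :: "'n rpoly"
    assume "suspect_rel p q" "suspect_rel q r"
    then show "suspect_rel p r"
      unfolding suspect_rel_def
      using prime_coneD(1)[OF suspect_cone, of "p - q" "q - r"] prime_coneD(1)[OF suspect_cone, of "r - q" "q - p"]
      by simp
  qed
qed

quotient_type 'n ordered_residue = "'n::finite rpoly" / suspect_rel
  morphisms rep_residue residue_class
  by (rule equivp_suspect_rel)

lemma suspect_rel_trans: "suspect_rel p q \<Longrightarrow> suspect_rel q r \<Longrightarrow> suspect_rel p r"
  by (rule equivp_transp[OF equivp_suspect_rel])

instantiation ordered_residue :: (finite) comm_ring_1
begin

lift_definition zero_ordered_residue :: "'a ordered_residue" is 0 .
lift_definition one_ordered_residue :: "'a ordered_residue" is 1 .
lift_definition plus_ordered_residue :: "'a ordered_residue \<Rightarrow> 'a ordered_residue \<Rightarrow> 'a ordered_residue" is "(+)"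
  by (rule suspect_rel_add)
lift_definition uminus_ordered_residue :: "'a ordered_residue \<Rightarrow> 'a ordered_residue" is uminus
  by (rule suspect_rel_uminus)
lift_definition minus_ordered_residue :: "'a ordered_residue \<Rightarrow> 'a ordered_residue \<Rightarrow> 'a ordered_residue" is "(-)"
proof -
  fix p q p' q' :: "'a rpoly"
  assume "suspect_rel p q" "suspect_rel p' q'"
  then show "suspect_rel (p - p') (q - q')"
    using suspect_rel_add[OF _ suspect_rel_uminus, of p q p' q'] by simp
qed
lift_definition times_ordered_residue :: "'a ordered_residue \<Rightarrow> 'a ordered_residue \<Rightarrow> 'a ordered_residue" is "(*)"
proof -
  fix p q p' q' :: "'a rpoly"
  assume "suspect_rel p q" "suspect_rel p' q'"
  then show "suspect_rel (p * p') (q * q')"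
    using suspect_rel_trans[of "p * p'" "p * q'" "q * q'"] suspect_rel_mult_left[of p' q' p]
      suspect_rel_mult_left[of p q q'] by (simp add: mult.commute)
qed

instance
proof
  fix x y z :: "'a ordered_residue"
  have refl: "suspect_rel p p" for p :: "'a rpoly" by (rule equivp_reflp[OF equivp_suspect_rel])
  show "x + y + z = x + (y + z)" by transfer (simp add: add.assoc refl)
  show "x + y = y + x" by transfer (simp add: add.commute refl)
  show "0 + x = x" by transfer (simp add: refl)
  show "- x + x = 0" by transfer (simp add: refl)
  show "x - y = x + - y" by transfer (simp add: refl)
  show "x * y * z = x * (y * z)" by transfer (simp add: mult.assoc refl)
  show "x * y = y * x" by transfer (simp add: mult.commute refl)
  show "1 * x = x" by transfer (simp add: refl)
  show "(x + y) * z = x * z + y * z" by transfer (simp add: distrib_right refl)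
  show "(0 :: 'a ordered_residue) \<noteq> 1"
    by transfer (simp add: suspect_rel_def prime_coneD(4)[OF suspect_cone])
qed

end

instantiation ordered_residue :: (finite) linordered_idom
begin

lift_definition less_eq_ordered_residue :: "'a ordered_residue \<Rightarrow> 'a ordered_residue \<Rightarrow> bool"
  is "\<lambda>p q. q - p \<in> suspect_cone"
proof -
  fix p q p' q' :: "'a rpoly"
  assume rel: "suspect_rel p q" "suspect_rel p' q'"
  have "q' - q \<in> suspect_cone" if "p' - p \<in> suspect_cone" "suspect_rel p q" "suspect_rel p' q'" for p q p' q' :: "'a rpoly"
  proof -
    have "q' - q = (q' - p') + ((p' - p) + (p - q))" by simp
    then show ?thesis using that prime_coneD(1)[OF suspect_cone] unfolding suspect_rel_def by metis
  qed
  then show "p' - p \<in> suspect_cone \<longleftrightarrow> q' - q \<in> suspect_cone"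
    using rel suspect_rel_sym by metis
qed
definition less_ordered_residue :: "'a ordered_residue \<Rightarrow> 'a ordered_residue \<Rightarrow> bool" where
  "less_ordered_residue x y \<longleftrightarrow> x \<le> y \<and> x \<noteq> y"
definition abs_ordered_residue :: "'a ordered_residue \<Rightarrow> 'a ordered_residue" where
  "abs_ordered_residue x = (if x < 0 then - x else x)"
definition sgn_ordered_residue :: "'a ordered_residue \<Rightarrow> 'a ordered_residue" where
  "sgn_ordered_residue x = (if x = 0 then 0 else if 0 < x then 1 else - 1)"

instance
proof
  fix x y z :: "'a ordered_residue"
  note cone = prime_coneD[OF suspect_cone]
  show refl: "x \<le> x" by transfer (simp add: cone)
  show antisym: "x \<le> y \<Longrightarrow> y \<le> x \<Longrightarrow> x = y" for x y :: "'a ordered_residue"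
    by transfer (simp add: suspect_rel_def)
  show "(x < y) = (x \<le> y \<and> \<not> y \<le> x)"
    using refl antisym by (auto simp: less_ordered_residue_def)
  show "x \<le> y \<Longrightarrow> y \<le> z \<Longrightarrow> x \<le> z"
  proof transfer
    fix p q r :: "'a rpoly"
    assume "q - p \<in> suspect_cone" "r - q \<in> suspect_cone"
    then show "r - p \<in> suspect_cone" using cone(1)[of "q - p" "r - q"] by simp
  qed
  show "x \<le> y \<or> y \<le> x"
  proof transfer
    fix p q :: "'a rpoly"
    show "q - p \<in> suspect_cone \<or> p - q \<in> suspect_cone" using cone(5)[of "q - p"] by simp
  qed
  show "x \<le> y \<Longrightarrow> z + x \<le> z + y" by transfer simp
  have no_zero_div: "x = 0 \<or> y = 0" if "x * y = 0" for x y :: "'a ordered_residue"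
    using that
  proof transfer
    fix p q :: "'a rpoly"
    assume "suspect_rel (p * q) 0"
    then show "suspect_rel p 0 \<or> suspect_rel q 0"
      using cone(6)[of p q] by (auto simp: suspect_rel_def)
  qed
  show "x < y \<Longrightarrow> 0 < z \<Longrightarrow> z * x < z * y"
  proof -
    assume xy: "x < y" "0 < z"
    then have "x \<noteq> y" "z \<noteq> 0" by (auto simp: less_ordered_residue_def)
    then have "z * x \<noteq> z * y" using no_zero_div[of z "x - y"] by (auto simp: algebra_simps)
    moreover have "z * x \<le> z * y"
    proof -
      have "x \<le> y" "0 \<le> z" using xy by (auto simp: less_ordered_residue_def)
      then show ?thesis
      proof transfer
        fix p q r :: "'a rpoly"
        assume "q - p \<in> suspect_cone" "r - 0 \<in> suspect_cone"
        then show "r * q - r * p \<in> suspect_cone"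
          using cone(2)[of r "q - p"] by (simp add: algebra_simps)
      qed
    qed
    ultimately show ?thesis by (simp add: less_ordered_residue_def)
  qed
  show "\<bar>x\<bar> = (if x < 0 then - x else x)" by (rule abs_ordered_residue_def)
  show "sgn x = (if x = 0 then 0 else if 0 < x then 1 else - 1)" by (rule sgn_ordered_residue_def)
qed

end

definition residue_point :: "'n::finite rpoly \<Rightarrow> 'n ordered_residue fract real_closure" where
  "residue_point p = of_base (Fract (residue_class p) 1)"

text \<open>
  The Artin-Lang theorem. The residue map into the real closure of the field of fractions is a ring
  homomorphism that translates membership in the cone into signs, and \<open>hom_sign_transfer\<close> applies to it.
\<close>
theorem prime_cone_realised:
  fixes P :: "'n::finite rpoly set"
  assumes "prime_cone P"
  shows "realised P"
proof (rule ccontr)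
  assume "\<not> realised P"
  then have not: "\<not> realised (suspect_cone :: 'n rpoly set)" using not_realised_suspect_cone assms by blast
  have "is_ring_hom (\<lambda>p :: 'n rpoly. Fract (residue_class p) 1)"
    by (simp add: is_ring_hom_def plus_ordered_residue.abs_eq times_ordered_residue.abs_eq
        one_ordered_residue_def[symmetric] One_fract_def)
  then have hom: "is_ring_hom (residue_point :: 'n rpoly \<Rightarrow> _)"
    using is_ring_hom_comp[OF _ is_ring_hom_of_base] unfolding residue_point_def by blast
  have sign: "0 < residue_point q \<longleftrightarrow> - q \<notin> suspect_cone" "residue_point q < 0 \<longleftrightarrow> q \<notin> suspect_cone" for q :: "'n rpoly"
  proof -
    have "0 \<le> residue_class q \<longleftrightarrow> q \<in> suspect_cone"
      by (simp add: zero_ordered_residue_def less_eq_ordered_residue.abs_eq)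
    moreover have "residue_class q \<le> 0 \<longleftrightarrow> - q \<in> suspect_cone"
      by (simp add: zero_ordered_residue_def less_eq_ordered_residue.abs_eq)
    moreover have "same_sign (residue_point q) (Fract (residue_class q) 1)"
      unfolding residue_point_def by (rule same_sign_of_base)
    note same_signD(1,2)[OF this]
    ultimately show "0 < residue_point q \<longleftrightarrow> - q \<notin> suspect_cone" "residue_point q < 0 \<longleftrightarrow> q \<notin> suspect_cone"
      by (simp_all add: zero_le_Fract_iff Fract_le_zero_iff zero_less_Fract_iff Fract_less_zero_iff flip: not_le)
  qed
  have "realised (suspect_cone :: 'n rpoly set)"
    unfolding realised_def
  proof (intro allI impI)
    fix Q :: "'n rpoly set" assume "finite Q"
    then obtain a where a: "\<forall>q\<in>Q. same_sign (residue_point q) (eval_poly q a)"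
      using hom_sign_transfer[OF hom] by blast
    have "(0 < eval_poly q a \<longleftrightarrow> - q \<notin> suspect_cone) \<and> (eval_poly q a < 0 \<longleftrightarrow> q \<notin> suspect_cone)"
      if "q \<in> Q" for q
      using a[rule_format, OF that] sign[of q] by (simp only: same_sign_def)
    then show "\<exists>a. \<forall>q\<in>Q. (0 < eval_poly q a \<longleftrightarrow> - q \<notin> suspect_cone) \<and> (eval_poly q a < 0 \<longleftrightarrow> q \<notin> suspect_cone)"
      by blast
  qed
  then show False using not by blast
qed

section \<open>The real Nullstellensatz\<close>

lemma sos_iff_list: "p \<in> sos \<longleftrightarrow> (\<exists>qs. p = (\<Sum>q\<leftarrow>qs. q\<^sup>2))"
proof
  assume "p \<in> sos"
  then obtain q and r :: nat where "p = (\<Sum>i<r. (q i)\<^sup>2)" by (auto simp: sos_def)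
  then have "p = (\<Sum>q\<leftarrow>map q [0..<r]. q\<^sup>2)" by (simp add: interv_sum_list_conv_sum_set_nat atLeast0LessThan o_def)
  then show "\<exists>qs. p = (\<Sum>q\<leftarrow>qs. q\<^sup>2)" by blast
next
  assume "\<exists>qs. p = (\<Sum>q\<leftarrow>qs. q\<^sup>2)"
  then obtain qs where "p = (\<Sum>q\<leftarrow>qs. q\<^sup>2)" by blast
  then have "p = (\<Sum>i<length qs. (qs ! i)\<^sup>2)" by (simp add: sum_list_sum_nth atLeast0LessThan)
  then show "p \<in> sos" unfolding sos_def by blast
qed

lemma sos_power2 [simp]: "q\<^sup>2 \<in> sos"
  unfolding sos_iff_list by (rule exI[of _ "[q]"]) simp

lemma sos_0 [simp]: "0 \<in> sos"
  unfolding sos_iff_list by (rule exI[of _ "[]"]) simp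

lemma sos_add: "p \<in> sos \<Longrightarrow> q \<in> sos \<Longrightarrow> p + q \<in> sos"
  unfolding sos_iff_list by (metis map_append sum_list_append)

lemma sos_mult:
  assumes "p \<in> sos" "q \<in> sos"
  shows "p * q \<in> sos"
proof -
  obtain ps qs where ps: "p = (\<Sum>a\<leftarrow>ps. a\<^sup>2)" and qs: "q = (\<Sum>b\<leftarrow>qs. b\<^sup>2)"
    using assms by (auto simp: sos_iff_list)
  have 1: "a\<^sup>2 * (\<Sum>b\<leftarrow>qs. b\<^sup>2) \<in> sos" for a :: "'a rpoly"
    by (induction qs) (simp_all add: distrib_left sos_add flip: power_mult_distrib)
  have "(\<Sum>a\<leftarrow>ps. a\<^sup>2) * (\<Sum>b\<leftarrow>qs. b\<^sup>2) \<in> sos"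
    by (induction ps) (simp_all add: distrib_right sos_add 1)
  then show ?thesis by (simp add: ps qs)
qed

lemma eval_poly_sos:
  assumes "p \<in> sos"
  shows "0 \<le> eval_poly p x"
proof -
  obtain q and r :: nat where "p = (\<Sum>i<r. (q i)\<^sup>2)" using assms by (auto simp: sos_def)
  then show ?thesis
    by (simp add: is_ring_homD(7,9)[OF is_ring_hom_eval_poly] sum_nonneg)
qed

definition poly_ideal :: "'n rpoly list \<Rightarrow> 'n rpoly set" where
  "poly_ideal h = {(\<Sum>i<length h. \<phi> i * h ! i) | \<phi>. True}"

lemma poly_idealI: "p = (\<Sum>i<length h. \<phi> i * h ! i) \<Longrightarrow> p \<in> poly_ideal h"
  unfolding poly_ideal_def by (intro CollectI exI[of _ \<phi>] conjI TrueI)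

lemma poly_ideal_add: "p \<in> poly_ideal h \<Longrightarrow> q \<in> poly_ideal h \<Longrightarrow> p + q \<in> poly_ideal h"
proof -
  assume "p \<in> poly_ideal h" "q \<in> poly_ideal h"
  then obtain \<phi> \<psi> where "p = (\<Sum>i<length h. \<phi> i * h ! i)" "q = (\<Sum>i<length h. \<psi> i * h ! i)"
    by (auto simp: poly_ideal_def)
  then have "p + q = (\<Sum>i<length h. (\<phi> i + \<psi> i) * h ! i)"
    by (simp add: distrib_right sum.distrib)
  then show ?thesis by (rule poly_idealI)
qed

lemma poly_ideal_mult: "p \<in> poly_ideal h \<Longrightarrow> r * p \<in> poly_ideal h"
proof -
  assume "p \<in> poly_ideal h"
  then obtain \<phi> where "p = (\<Sum>i<length h. \<phi> i * h ! i)" by (auto simp: poly_ideal_def)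
  then have "r * p = (\<Sum>i<length h. (r * \<phi> i) * h ! i)"
    by (simp add: sum_distrib_left mult.assoc)
  then show ?thesis by (rule poly_idealI)
qed

lemma poly_ideal_uminus: "p \<in> poly_ideal h \<Longrightarrow> - p \<in> poly_ideal h"
  using poly_ideal_mult[of p h "- 1"] by simp

lemma poly_ideal_nth: "i < length h \<Longrightarrow> h ! i \<in> poly_ideal h"
proof -
  assume "i < length h"
  then have "h ! i = (\<Sum>j<length h. (if j = i then 1 else 0) * h ! j)"
    by (simp add: if_distrib[of "\<lambda>c. c * _"] cong: if_cong)
  then show ?thesis by (rule poly_idealI)
qed

lemma poly_ideal_0: "0 \<in> poly_ideal h"
  by (rule poly_idealI[where \<phi> = "\<lambda>_. 0"]) simp

text \<open>
  If the conclusion fails, then the preordering \<open>T\<close> of sums of squares plus ideal elements avoids the negatives of all even powers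
  of \<open>p\<close>. A prime cone containing it contains \<open>\<plusminus> h\<^sub>i\<close> but not both \<open>p\<close> and \<open>- p\<close>. Its signs are realised at a real
  point, which then lies in the variety although \<open>p\<close> does not vanish there.
\<close>
theorem real_nullstellensatz:
  fixes p :: "'n::finite rpoly"
  assumes zero: "\<And>x. x \<in> real_variety h \<Longrightarrow> eval_poly p x = 0"
  shows "\<exists>l. \<exists>s\<in>sos. p ^ (2 * l) + s \<in> poly_ideal h"
proof (rule ccontr)
  assume none: "\<not> ?thesis"
  define T where "T = {s + q | s q. s \<in> sos \<and> q \<in> poly_ideal h}"
  define S where "S = range (\<lambda>l. p ^ (2 * l))"
  have T_intro: "s + q \<in> T" if "s \<in> sos" "q \<in> poly_ideal h" for s q
    using that unfolding T_def by blast
  have T_elim: "\<exists>s\<in>sos. \<exists>q\<in>poly_ideal h. x = s + q" if "x \<in> T" for x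
    using that unfolding T_def by blast
  have T_sos: "s \<in> T" if "s \<in> sos" for s using T_intro[OF that poly_ideal_0] by simp
  have T_ideal: "q \<in> T" if "q \<in> poly_ideal h" for q using T_intro[OF sos_0 that] by simp
  have T: "ring_preordering UNIV T"
    unfolding ring_preordering_def
  proof (intro conjI ballI)
    fix x :: "'n rpoly"
    show "x * x \<in> T" using T_sos[OF sos_power2[of x]] by (simp add: power2_eq_square)
  next
    fix x y assume "x \<in> T" "y \<in> T"
    then obtain s q t r where x: "x = s + q" "s \<in> sos" "q \<in> poly_ideal h"
      and y: "y = t + r" "t \<in> sos" "r \<in> poly_ideal h"
      using T_elim by metis
    have sum: "x + y = (s + t) + (q + r)" unfolding x y by (simp only: ac_simps)
    have prod: "x * y = s * t + (s * r + (t + r) * q)" unfolding x y by (simp add: distrib_left distrib_right ac_simps)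
    show "x + y \<in> T"
      unfolding sum by (rule T_intro[OF sos_add[OF x(2) y(2)] poly_ideal_add[OF x(3) y(3)]])
    show "x * y \<in> T"
      unfolding prod by (rule T_intro[OF sos_mult[OF x(2) y(2)] poly_ideal_add[OF poly_ideal_mult[OF y(3)] poly_ideal_mult[OF x(3)]]])
  qed simp
  have S1: "S \<subseteq> T" using T_sos by (auto simp: S_def power_mult mult.commute[of 2])
  have S2: "1 \<in> S" unfolding S_def by (rule range_eqI[of _ _ 0]) simp
  have S3: "s * t \<in> S" if st: "s \<in> S" "t \<in> S" for s t
  proof -
    obtain k l where "s = p ^ (2 * k)" "t = p ^ (2 * l)" using st by (auto simp: S_def)
    then have "s * t = p ^ (2 * (k + l))" by (simp add: power_add distrib_left)
    then show ?thesis unfolding S_def by (rule range_eqI)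
  qed
  have S4: "- s \<notin> T" if "s \<in> S" for s
  proof
    assume "- s \<in> T"
    then obtain t q where "- s = t + q" "t \<in> sos" "q \<in> poly_ideal h" using T_elim by metis
    moreover have "s + t = - q"
    proof -
      have "q = - s - t" using \<open>- s = t + q\<close> by simp
      then show ?thesis by (simp add: add.commute)
    qed
    ultimately have "s + t \<in> poly_ideal h" using poly_ideal_uminus by metis
    then show False using none \<open>t \<in> sos\<close> that by (auto simp: S_def)
  qed
  have "\<exists>P. T \<subseteq> P \<and> ring_preordering UNIV P \<and> (\<forall>s\<in>S. - s \<notin> P) \<and> (\<forall>x\<in>UNIV. x \<in> P \<or> - x \<in> P) \<and>
      (\<forall>x\<in>UNIV. \<forall>y\<in>UNIV. x * y \<in> P \<and> - (x * y) \<in> P \<longrightarrow> (x \<in> P \<and> - x \<in> P) \<or> (y \<in> P \<and> - y \<in> P))"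
  proof (rule ring_preordering_extends_to_cone[OF _ T S1 S2])
    show "is_subring (UNIV :: 'n rpoly set)" by (simp add: is_subring_def)
  qed (fact S3 | fact S4)+
  then obtain P where P: "T \<subseteq> P" "ring_preordering UNIV P" "\<forall>s\<in>S. - s \<notin> P" "\<forall>x\<in>UNIV. x \<in> P \<or> - x \<in> P"
    "\<forall>x\<in>UNIV. \<forall>y\<in>UNIV. x * y \<in> P \<and> - (x * y) \<in> P \<longrightarrow> (x \<in> P \<and> - x \<in> P) \<or> (y \<in> P \<and> - y \<in> P)"
    by (elim exE conjE) (rule that; assumption)
  have cone: "prime_cone P"
    unfolding prime_cone_def using P(2,4,5) P(3)[rule_format, OF S2] by simp
  obtain a where a: "\<And>q. q \<in> insert p (set h) \<Longrightarrow> (0 < eval_poly q a \<longleftrightarrow> - q \<notin> P) \<and> (eval_poly q a < 0 \<longleftrightarrow> q \<notin> P)"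
  proof -
    have "finite (insert p (set h))" by simp
    then show ?thesis using prime_cone_realised[OF cone] that unfolding realised_def by blast
  qed
  have "eval_poly (h ! i) a = 0" if "i < length h" for i
  proof -
    have "h ! i \<in> P" "- (h ! i) \<in> P"
      using P(1) T_ideal poly_ideal_nth[OF that] poly_ideal_uminus by blast+
    then show ?thesis using a[of "h ! i"] that by auto
  qed
  then have "eval_poly p a = 0" using zero by (simp add: real_variety_def)
  then have "p \<in> P" "- p \<in> P" using a[of p] by auto
  then have "- (p ^ (2 * 1)) \<in> P"
    using prime_coneD(2)[OF cone, of "- p" p] by (simp add: power2_eq_square)
  moreover have "p ^ (2 * 1) \<in> S" unfolding S_def by (rule rangeI)
  ultimately show False using P(3) by blast
qed

section \<open>The truncated cones of the hierarchy\<close>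

lemma total_degree_le_iff:
  "total_degree p \<le> d \<longleftrightarrow> (\<forall>m\<in>Poly_Mapping.keys p. (\<Sum>i\<in>UNIV. Poly_Mapping.lookup m i) \<le> d)"
  unfolding total_degree_def by (subst Max_le_iff) auto

lemma total_degree_add_le:
  assumes "total_degree p \<le> d" "total_degree q \<le> d"
  shows "total_degree (p + q) \<le> d"
  using assms Poly_Mapping.keys_add[of p q] unfolding total_degree_le_iff by blast

lemma total_degree_mult_le:
  assumes "total_degree p \<le> d" "total_degree q \<le> e"
  shows "total_degree (p * q) \<le> d + e"
  unfolding total_degree_le_iff
proof
  fix m assume "m \<in> Poly_Mapping.keys (p * q)"
  then obtain a b where m: "m = a + b" "a \<in> Poly_Mapping.keys p" "b \<in> Poly_Mapping.keys q"
    using keys_mult[of p q] by blast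
  have "(\<Sum>i\<in>UNIV. Poly_Mapping.lookup m i)
      = (\<Sum>i\<in>UNIV. Poly_Mapping.lookup a i) + (\<Sum>i\<in>UNIV. Poly_Mapping.lookup b i)"
    by (simp add: m lookup_add sum.distrib)
  then show "(\<Sum>i\<in>UNIV. Poly_Mapping.lookup m i) \<le> d + e"
    using assms m unfolding total_degree_le_iff by (metis add_mono)
qed

lemma total_degree_0 [simp]: "total_degree 0 = 0"
  by (simp add: total_degree_def)

lemma total_degree_const_poly [simp]: "total_degree (const_poly c) = 0"
  using total_degree_le_iff[of "const_poly c" 0] by (auto simp: const_poly_def split: if_splits)

lemma total_degree_const_mult_le: "total_degree p \<le> d \<Longrightarrow> total_degree (const_poly c * p) \<le> d"
  using total_degree_mult_le[of "const_poly c" 0 p d] by simp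

lemmas const_poly_hom = is_ring_homD[OF is_ring_hom_const_poly]
lemma const_poly_2: "const_poly 2 = 2"
  using const_poly_hom(2)[of 1 1] by (simp add: const_poly_1)

lemmas eval_poly_hom = is_ring_homD[OF is_ring_hom_eval_poly]

definition truncated_cone :: "'n::finite rpoly list \<Rightarrow> 'n rpoly list \<Rightarrow> nat \<Rightarrow> 'n rpoly set" where
  "truncated_cone h g k = {p + q | p q. p \<in> truncated_ideal h (2 * k) \<and> q \<in> truncated_qmodule g k}"

lemma truncated_coneI:
  "p \<in> truncated_ideal h (2 * k) \<Longrightarrow> q \<in> truncated_qmodule g k \<Longrightarrow> p + q \<in> truncated_cone h g k"
  unfolding truncated_cone_def by blast

lemma truncated_idealI:
  assumes "\<And>i. i < length h \<Longrightarrow> total_degree (\<phi> i * h ! i) \<le> d"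
  shows "(\<Sum>i<length h. \<phi> i * h ! i) \<in> truncated_ideal h d"
  unfolding truncated_ideal_def using assms by (intro CollectI exI[of _ \<phi>]) auto

lemma truncated_qmoduleI:
  assumes "\<And>j. j \<le> length g \<Longrightarrow> \<sigma> j \<in> sos \<and> total_degree (\<sigma> j * (1 # g) ! j) \<le> 2 * k"
  shows "(\<Sum>j\<le>length g. \<sigma> j * (1 # g) ! j) \<in> truncated_qmodule g k"
  unfolding truncated_qmodule_def using assms by (intro CollectI exI[of _ \<sigma>]) auto

lemma sos_const_mult: "0 \<le> c \<Longrightarrow> s \<in> sos \<Longrightarrow> const_poly c * s \<in> sos"
proof -
  assume "0 \<le> c" "s \<in> sos"
  then have "const_poly c = (const_poly (sqrt c))\<^sup>2"
    by (simp flip: const_poly_hom(7))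
  then show ?thesis using sos_mult[OF sos_power2 \<open>s \<in> sos\<close>, of "const_poly (sqrt c)"] by metis
qed

lemma truncated_ideal_add:
  assumes "p \<in> truncated_ideal h d" "q \<in> truncated_ideal h d"
  shows "p + q \<in> truncated_ideal h d"
proof -
  obtain \<phi> where p: "p = (\<Sum>i<length h. \<phi> i * h ! i)" "\<forall>i<length h. total_degree (\<phi> i * h ! i) \<le> d"
    using assms(1) unfolding truncated_ideal_def by blast
  obtain \<psi> where q: "q = (\<Sum>i<length h. \<psi> i * h ! i)" "\<forall>i<length h. total_degree (\<psi> i * h ! i) \<le> d"
    using assms(2) unfolding truncated_ideal_def by blast
  have "p + q = (\<Sum>i<length h. (\<phi> i + \<psi> i) * h ! i)"
    by (simp add: p q distrib_right sum.distrib)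
  also have "\<dots> \<in> truncated_ideal h d"
    using p(2) q(2) by (intro truncated_idealI) (simp add: distrib_right total_degree_add_le)
  finally show ?thesis .
qed

lemma truncated_ideal_const_mult:
  assumes "p \<in> truncated_ideal h d"
  shows "const_poly c * p \<in> truncated_ideal h d"
proof -
  obtain \<phi> where p: "p = (\<Sum>i<length h. \<phi> i * h ! i)" "\<forall>i<length h. total_degree (\<phi> i * h ! i) \<le> d"
    using assms(1) unfolding truncated_ideal_def by blast
  have "const_poly c * p = (\<Sum>i<length h. (const_poly c * \<phi> i) * h ! i)"
    by (simp add: p sum_distrib_left mult.assoc)
  also have "\<dots> \<in> truncated_ideal h d"
    using p(2) by (intro truncated_idealI) (simp add: mult.assoc total_degree_const_mult_le)
  finally show ?thesis .
qed

lemma truncated_qmodule_add: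
  assumes "p \<in> truncated_qmodule g k" "q \<in> truncated_qmodule g k"
  shows "p + q \<in> truncated_qmodule g k"
proof -
  obtain \<sigma> where p: "p = (\<Sum>j\<le>length g. \<sigma> j * (1 # g) ! j)"
    "\<forall>j\<le>length g. \<sigma> j \<in> sos \<and> total_degree (\<sigma> j * (1 # g) ! j) \<le> 2 * k"
    using assms(1) unfolding truncated_qmodule_def by blast
  obtain \<tau> where q: "q = (\<Sum>j\<le>length g. \<tau> j * (1 # g) ! j)"
    "\<forall>j\<le>length g. \<tau> j \<in> sos \<and> total_degree (\<tau> j * (1 # g) ! j) \<le> 2 * k"
    using assms(2) unfolding truncated_qmodule_def by blast
  have "p + q = (\<Sum>j\<le>length g. (\<sigma> j + \<tau> j) * (1 # g) ! j)"
    by (simp add: p q distrib_right sum.distrib)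
  also have "\<dots> \<in> truncated_qmodule g k"
    using p(2) q(2) by (intro truncated_qmoduleI) (simp add: distrib_right total_degree_add_le sos_add)
  finally show ?thesis .
qed

lemma truncated_qmodule_const_mult:
  assumes "0 \<le> c" "p \<in> truncated_qmodule g k"
  shows "const_poly c * p \<in> truncated_qmodule g k"
proof -
  obtain \<sigma> where p: "p = (\<Sum>j\<le>length g. \<sigma> j * (1 # g) ! j)"
    "\<forall>j\<le>length g. \<sigma> j \<in> sos \<and> total_degree (\<sigma> j * (1 # g) ! j) \<le> 2 * k"
    using assms(2) unfolding truncated_qmodule_def by blast
  have "const_poly c * p = (\<Sum>j\<le>length g. (const_poly c * \<sigma> j) * (1 # g) ! j)"
    by (simp add: p sum_distrib_left mult.assoc)
  also have "\<dots> \<in> truncated_qmodule g k"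
    using p(2) assms(1) by (intro truncated_qmoduleI) (simp add: mult.assoc total_degree_const_mult_le sos_const_mult)
  finally show ?thesis .
qed

lemma truncated_cone_add:
  assumes "p \<in> truncated_cone h g k" "q \<in> truncated_cone h g k"
  shows "p + q \<in> truncated_cone h g k"
proof -
  obtain a b where p: "p = a + b" "a \<in> truncated_ideal h (2 * k)" "b \<in> truncated_qmodule g k"
    using assms(1) unfolding truncated_cone_def by blast
  obtain c d where q: "q = c + d" "c \<in> truncated_ideal h (2 * k)" "d \<in> truncated_qmodule g k"
    using assms(2) unfolding truncated_cone_def by blast
  have "p + q = (a + c) + (b + d)" by (simp only: p(1) q(1) ac_simps)
  then show ?thesis
    using truncated_ideal_add[OF p(2) q(2)] truncated_qmodule_add[OF p(3) q(3)]
    unfolding truncated_cone_def by blast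
qed

lemma truncated_cone_const_mult:
  assumes "0 \<le> c" "p \<in> truncated_cone h g k"
  shows "const_poly c * p \<in> truncated_cone h g k"
proof -
  obtain a b where p: "p = a + b" "a \<in> truncated_ideal h (2 * k)" "b \<in> truncated_qmodule g k"
    using assms(2) unfolding truncated_cone_def by blast
  have "const_poly c * p = const_poly c * a + const_poly c * b" by (simp add: p(1) distrib_left)
  then show ?thesis
    using truncated_ideal_const_mult[OF p(2)] truncated_qmodule_const_mult[OF assms(1) p(3)]
    unfolding truncated_cone_def by blast
qed

lemma truncated_cone_mono:
  assumes "k \<le> l" "p \<in> truncated_cone h g k"
  shows "p \<in> truncated_cone h g l"
proof -
  obtain a b where p: "p = a + b" "a \<in> truncated_ideal h (2 * k)" "b \<in> truncated_qmodule g k"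
    using assms(2) unfolding truncated_cone_def by blast
  obtain \<phi> where a: "a = (\<Sum>i<length h. \<phi> i * h ! i)" "\<forall>i<length h. total_degree (\<phi> i * h ! i) \<le> 2 * k"
    using p(2) unfolding truncated_ideal_def by blast
  obtain \<sigma> where b: "b = (\<Sum>j\<le>length g. \<sigma> j * (1 # g) ! j)"
    "\<forall>j\<le>length g. \<sigma> j \<in> sos \<and> total_degree (\<sigma> j * (1 # g) ! j) \<le> 2 * k"
    using p(3) unfolding truncated_qmodule_def by blast
  have kl: "2 * k \<le> 2 * l" using assms(1) by simp
  have "a \<in> truncated_ideal h (2 * l)"
    unfolding a(1) using a(2) order_trans[OF _ kl] by (intro truncated_idealI) blast
  moreover have "b \<in> truncated_qmodule g l"
    unfolding b(1) using b(2) order_trans[OF _ kl] by (intro truncated_qmoduleI) blast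
  ultimately show ?thesis using p(1) unfolding truncated_cone_def by blast
qed

lemma zero_in_truncated_ideal: "0 \<in> truncated_ideal h d"
  using truncated_idealI[of h "\<lambda>_. 0" d] by simp

lemma zero_in_truncated_qmodule: "0 \<in> truncated_qmodule g k"
  using truncated_qmoduleI[of g "\<lambda>_. 0" k] by simp

lemma sos_mult_in_truncated_cone:
  assumes "s \<in> sos" "j \<le> length g" "total_degree (s * (1 # g) ! j) \<le> 2 * k"
  shows "s * (1 # g) ! j \<in> truncated_cone h g k"
proof -
  have "(\<Sum>i\<le>length g. (if i = j then s else 0) * (1 # g) ! i) \<in> truncated_qmodule g k"
    using assms by (intro truncated_qmoduleI) auto
  moreover have "(\<Sum>i\<le>length g. (if i = j then s else 0) * (1 # g) ! i) = s * (1 # g) ! j"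
    using assms(2) by (simp add: if_distrib[of "\<lambda>c. c * _"] cong: if_cong)
  ultimately have "0 + s * (1 # g) ! j \<in> truncated_cone h g k"
    by (intro truncated_coneI zero_in_truncated_ideal) simp
  then show ?thesis by simp
qed

lemma power2_in_truncated_cone:
  assumes "total_degree q \<le> k"
  shows "q\<^sup>2 \<in> truncated_cone h g k"
proof -
  have "total_degree (q\<^sup>2) \<le> 2 * k"
    using total_degree_mult_le[OF assms assms] by (simp add: power2_eq_square mult_2)
  then show ?thesis using sos_mult_in_truncated_cone[of "q\<^sup>2" 0 g k h] by simp
qed

lemma const_in_truncated_cone: "0 \<le> c \<Longrightarrow> const_poly c \<in> truncated_cone h g k"
  using power2_in_truncated_cone[of "const_poly (sqrt c)" k h g] by (simp flip: const_poly_hom(7))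

lemma poly_ideal_in_truncated_cone:
  assumes "p \<in> poly_ideal h"
  shows "\<exists>k. p \<in> truncated_cone h g k"
proof -
  obtain \<phi> where p: "p = (\<Sum>i<length h. \<phi> i * h ! i)" using assms unfolding poly_ideal_def by blast
  define k where "k = (\<Sum>i<length h. total_degree (\<phi> i * h ! i))"
  have "total_degree (\<phi> i * h ! i) \<le> 2 * k" if "i < length h" for i
    using member_le_sum[of i "{..<length h}" "\<lambda>i. total_degree (\<phi> i * h ! i)"] that by (simp add: k_def)
  then have "p \<in> truncated_ideal h (2 * k)" unfolding p by (rule truncated_idealI)
  then have "p + 0 \<in> truncated_cone h g k"
    by (rule truncated_coneI[OF _ zero_in_truncated_qmodule])
  then show ?thesis by auto
qed

lemma sos_mult_in_some_truncated_cone: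
  assumes "s \<in> sos" "j \<le> length g"
  shows "\<exists>k. s * (1 # g) ! j \<in> truncated_cone h g k"
  using sos_mult_in_truncated_cone[OF assms, of "total_degree (s * (1 # g) ! j)"] by auto

lemma some_truncated_cone_add:
  assumes "\<exists>k. p \<in> truncated_cone h g k" "\<exists>k. q \<in> truncated_cone h g k"
  shows "\<exists>k. p + q \<in> truncated_cone h g k"
proof -
  obtain k l where "p \<in> truncated_cone h g k" "q \<in> truncated_cone h g l" using assms by blast
  then have "p \<in> truncated_cone h g (max k l)" "q \<in> truncated_cone h g (max k l)"
    by (auto intro: truncated_cone_mono[rotated])
  then show ?thesis using truncated_cone_add by blast
qed

text \<open>
  Descends from \<open>u\<^sup>2\<close> to \<open>u\<close> by \<open>\<epsilon> - c u = (\<alpha> - \<beta> u)\<^sup>2 + (\<epsilon> / 2 - \<beta>\<^sup>2 u\<^sup>2)\<close>, where \<open>\<alpha>\<^sup>2 = \<epsilon> / 2\<close> and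
  \<open>2 \<alpha> \<beta> = c\<close>. Only powers of \<open>p\<close> below the \<open>2\<^sup>m\<close>-th are squared, with arbitrary real coefficients, so one \<open>k\<close> serves all \<open>\<epsilon>\<close>
  and \<open>c\<close>.
\<close>
lemma minus_power_perturbation_in_truncated_cone:
  assumes deg: "\<And>j. j < m \<Longrightarrow> total_degree (p ^ 2 ^ j) \<le> k"
    and top: "- (p ^ 2 ^ m) \<in> truncated_cone h g k"
    and "i \<le> m" "0 < \<epsilon>" "0 \<le> c"
  shows "const_poly \<epsilon> - const_poly c * p ^ 2 ^ (m - i) \<in> truncated_cone h g k"
  using assms(3-5)
proof (induction i arbitrary: \<epsilon> c)
  case 0
  have "const_poly \<epsilon> + const_poly c * (- (p ^ 2 ^ m)) \<in> truncated_cone h g k"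
    using 0 by (intro truncated_cone_add const_in_truncated_cone truncated_cone_const_mult top) auto
  then show ?case by simp
next
  case (Suc i)
  define u where "u = p ^ 2 ^ (m - Suc i)"
  have u2: "p ^ 2 ^ (m - i) = u\<^sup>2"
    using Suc.prems(1) by (simp add: u_def flip: power_mult power_Suc2 Suc_diff_Suc)
  define \<alpha> where "\<alpha> = sqrt (\<epsilon> / 2)"
  define \<beta> where "\<beta> = c / (2 * \<alpha>)"
  have \<alpha>: "\<alpha> > 0" "\<alpha>\<^sup>2 = \<epsilon> / 2" using Suc.prems by (simp_all add: \<alpha>_def)
  have "total_degree (const_poly \<alpha> + const_poly (- \<beta>) * u) \<le> k"
    using deg[of "m - Suc i"] Suc.prems(1)
    by (intro total_degree_add_le total_degree_const_mult_le) (simp_all add: u_def)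
  then have sq: "(const_poly \<alpha> + const_poly (- \<beta>) * u)\<^sup>2 \<in> truncated_cone h g k"
    by (rule power2_in_truncated_cone)
  have rest: "const_poly (\<epsilon> / 2) - const_poly (\<beta>\<^sup>2) * u\<^sup>2 \<in> truncated_cone h g k"
    using Suc.IH[of "\<epsilon> / 2" "\<beta>\<^sup>2"] Suc.prems u2 by simp
  have "(const_poly \<alpha> + const_poly (- \<beta>) * u)\<^sup>2 =
      const_poly (\<alpha>\<^sup>2) + const_poly (\<beta>\<^sup>2) * u\<^sup>2 - const_poly (\<alpha> * \<beta> + \<alpha> * \<beta>) * u"
    by (simp add: power2_eq_square const_poly_hom(2,3,5) const_poly_2 algebra_simps)
  moreover have "\<alpha> * \<beta> + \<alpha> * \<beta> = c" using \<alpha>(1) by (simp add: \<beta>_def)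
  ultimately have "(const_poly \<alpha> + const_poly (- \<beta>) * u)\<^sup>2 + (const_poly (\<epsilon> / 2) - const_poly (\<beta>\<^sup>2) * u\<^sup>2) =
      (const_poly (\<epsilon> / 2) + const_poly (\<epsilon> / 2)) - const_poly c * u"
    by (simp add: \<alpha>(2))
  also have "\<dots> = const_poly \<epsilon> - const_poly c * u"
    by (simp flip: const_poly_hom(2))
  finally show ?case using truncated_cone_add[OF sq rest] by (simp add: u_def)
qed

text \<open>
  The Nullstellensatz gives an even power \<open>2 l\<close>; multiplying by a square raises it to \<open>2\<^sup>l\<^sup>+\<^sup>1\<close>, from which
  square roots can be taken down to the first power. It is applied to \<open>- p\<close> because the descent ends in \<open>\<epsilon> - (- p)\<close>.
\<close>
lemma perturbation_in_truncated_cone: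
  fixes p :: "'n::finite rpoly"
  assumes zero: "\<And>x. x \<in> real_variety h \<Longrightarrow> eval_poly p x = 0"
  shows "\<exists>k. \<forall>\<epsilon>>0. p + const_poly \<epsilon> \<in> truncated_cone h g k"
proof -
  obtain l s where s: "s \<in> sos" "(- p) ^ (2 * l) + s \<in> poly_ideal h"
    using real_nullstellensatz[of h "- p"] zero by (auto simp: eval_poly_hom)
  define m where "m = Suc l"
  define d where "d = 2 ^ l - l"
  have "l \<le> 2 ^ l" using less_exp[of l] by simp
  then have "(2::nat) ^ l = l + d" by (simp add: d_def)
  then have "2 ^ m = 2 * l + 2 * d" by (simp add: m_def)
  then have "(- p) ^ 2 ^ m = (- p) ^ (2 * l) * ((- p) ^ d)\<^sup>2"
    by (simp add: power_add power_mult mult.commute[of 2])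
  then have "- ((- p) ^ 2 ^ m) = - (((- p) ^ d)\<^sup>2 * ((- p) ^ (2 * l) + s)) + (((- p) ^ d)\<^sup>2 * s) * (1 # g) ! 0"
    by (simp add: algebra_simps)
  moreover have "\<exists>k. - (((- p) ^ d)\<^sup>2 * ((- p) ^ (2 * l) + s)) + (((- p) ^ d)\<^sup>2 * s) * (1 # g) ! 0 \<in> truncated_cone h g k"
    by (intro some_truncated_cone_add poly_ideal_in_truncated_cone poly_ideal_uminus poly_ideal_mult
        sos_mult_in_some_truncated_cone sos_mult sos_power2 s) simp
  ultimately obtain k0 where k0: "- ((- p) ^ 2 ^ m) \<in> truncated_cone h g k0" by auto
  define k where "k = k0 + (\<Sum>j\<le>m. total_degree ((- p) ^ 2 ^ j))"
  have deg: "total_degree ((- p) ^ 2 ^ j) \<le> k" if "j \<le> m" for j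
    using member_le_sum[of j "{..m}" "\<lambda>j. total_degree ((- p) ^ 2 ^ j)"] that by (simp add: k_def)
  have "- ((- p) ^ 2 ^ m) \<in> truncated_cone h g k"
    using k0 by (rule truncated_cone_mono[rotated]) (simp add: k_def)
  then have "const_poly \<epsilon> - const_poly 1 * (- p) ^ 2 ^ (m - m) \<in> truncated_cone h g k" if "0 < \<epsilon>" for \<epsilon>
    using deg that by (intro minus_power_perturbation_in_truncated_cone) auto
  then show ?thesis by (auto simp: const_poly_1 add.commute)
qed

section \<open>Finite convergence\<close>

text \<open>
  A product of squared distances, normalised at \<open>u\<close>.
\<close>
lemma exists_interpolation_polynomial:
  fixes V :: "(real ^ 'n::finite) set"
  assumes "finite V" "u \<in> V"
  shows "\<exists>p. eval_poly p u = 1 \<and> (\<forall>v\<in>V - {u}. eval_poly p v = 0)"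
proof -
  define sep where "sep = (\<lambda>v :: real ^ 'n. \<Sum>i\<in>UNIV. (variable i - const_poly (v $ i))\<^sup>2)"
  define p where "p = (\<Prod>v\<in>V - {u}. sep v)"
  have sep: "eval_poly (sep v) x = (\<Sum>i\<in>UNIV. (x $ i - v $ i)\<^sup>2)" for v x
    by (simp add: sep_def eval_poly_hom)
  have p: "eval_poly p x = (\<Prod>v\<in>V - {u}. eval_poly (sep v) x)" for x
    by (simp add: p_def eval_poly_hom)
  have "eval_poly (sep v) u \<noteq> 0" if "v \<noteq> u" for v
    using that by (simp add: sep sum_nonneg_eq_0_iff vec_eq_iff) metis
  then have "eval_poly p u \<noteq> 0" using assms(1) by (simp add: p)
  moreover have "eval_poly p v = 0" if "v \<in> V - {u}" for v
  proof -
    have "eval_poly (sep v) v = 0" by (simp add: sep)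
    then show ?thesis unfolding p using assms(1) that by (meson finite_Diff prod_zero)
  qed
  ultimately show ?thesis
    by (intro exI[of _ "const_poly (inverse (eval_poly p u)) * p"]) (simp add: eval_poly_hom)
qed

text \<open>
  The element \<open>q\<close> of the quadratic module agrees with \<open>f - \<gamma>\<close> on the variety, and the difference is
  certified by \<open>perturbation_in_truncated_cone\<close>. At an infeasible point where \<open>f\<close> falls below \<open>\<gamma>\<close> the value of \<open>q\<close> is produced by
  a constraint \<open>g\<^sub>j\<close> that is negative there; in all other cases the constraint \<open>g\<^sub>0 = 1\<close> does.
\<close>
theorem lower_bound_in_truncated_cone:
  fixes f :: "'n::finite rpoly"
  assumes fin: "finite (real_variety h)" and bound: "\<And>x. x \<in> feasible_set h g \<Longrightarrow> \<gamma> \<le> eval_poly f x"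
  shows "\<exists>k. \<forall>\<epsilon>>0. f - const_poly \<gamma> + const_poly \<epsilon> \<in> truncated_cone h g k"
proof -
  define V where "V = real_variety h"
  have "\<exists>\<phi>. \<forall>u\<in>V. eval_poly (\<phi> u) u = 1 \<and> (\<forall>v\<in>V - {u}. eval_poly (\<phi> u) v = 0)"
    using exists_interpolation_polynomial fin unfolding V_def by (intro bchoice) blast
  then obtain \<phi> where \<phi>: "\<And>u. u \<in> V \<Longrightarrow> eval_poly (\<phi> u) u = 1"
    "\<And>u v. u \<in> V \<Longrightarrow> v \<in> V \<Longrightarrow> v \<noteq> u \<Longrightarrow> eval_poly (\<phi> u) v = 0"
    by blast
  have "\<exists>c j. 0 \<le> c \<and> j \<le> length g \<and> c * eval_poly ((1 # g) ! j) u = eval_poly f u - \<gamma>" if uV: "u \<in> V" for u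
  proof (cases "\<gamma> \<le> eval_poly f u")
    case True
    then show ?thesis
      by (intro exI[of _ "eval_poly f u - \<gamma>"] exI[of _ 0]) (simp add: eval_poly_hom)
  next
    case False
    then have "u \<notin> feasible_set h g" using bound by blast
    then obtain j where j: "j < length g" "eval_poly (g ! j) u < 0"
      using uV by (auto simp: V_def real_variety_def feasible_set_def not_le)
    then show ?thesis using False
      by (intro exI[of _ "(eval_poly f u - \<gamma>) / eval_poly (g ! j) u"] exI[of _ "Suc j"])
        (auto intro: divide_nonpos_neg)
  qed
  then have "\<forall>u. \<exists>c j. u \<in> V \<longrightarrow> 0 \<le> c \<and> j \<le> length g \<and> c * eval_poly ((1 # g) ! j) u = eval_poly f u - \<gamma>"
    by blast
  then obtain c j where cj: "\<And>u. u \<in> V \<Longrightarrow> 0 \<le> c u \<and> j u \<le> length g \<and> c u * eval_poly ((1 # g) ! j u) u = eval_poly f u - \<gamma>"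
    by metis
  define q where "q = (\<Sum>u\<in>V. (const_poly (c u) * (\<phi> u)\<^sup>2) * (1 # g) ! j u)"
  have "\<exists>k. (\<Sum>u\<in>W. (const_poly (c u) * (\<phi> u)\<^sup>2) * (1 # g) ! j u) \<in> truncated_cone h g k" if "W \<subseteq> V" "finite W" for W
    using that(2,1)
  proof induction
    case empty
    then show ?case using const_in_truncated_cone[of 0 h g] by (auto simp: const_poly_hom)
  next
    case (insert u W)
    have "\<exists>k. (const_poly (c u) * (\<phi> u)\<^sup>2) * (1 # g) ! j u \<in> truncated_cone h g k"
      using cj[of u] insert.prems by (intro sos_mult_in_some_truncated_cone sos_const_mult) auto
    then show ?case using insert by (simp add: some_truncated_cone_add)
  qed
  then obtain k1 where k1: "q \<in> truncated_cone h g k1" using fin unfolding q_def V_def by blast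
  have "eval_poly (f - const_poly \<gamma> - q) x = 0" if "x \<in> real_variety h" for x
  proof -
    have x: "x \<in> V" using that by (simp add: V_def)
    have "eval_poly q x = (\<Sum>u\<in>V. (c u * (eval_poly (\<phi> u) x)\<^sup>2) * eval_poly ((1 # g) ! j u) x)"
      by (simp add: q_def eval_poly_hom)
    also have "\<dots> = (\<Sum>u\<in>V. if u = x then eval_poly f x - \<gamma> else 0)"
      using \<phi> cj x by (intro sum.cong) auto
    also have "\<dots> = eval_poly f x - \<gamma>" using fin x by (simp add: V_def)
    finally show ?thesis by (simp add: eval_poly_hom)
  qed
  then obtain k2 where k2: "\<And>\<epsilon>. 0 < \<epsilon> \<Longrightarrow> f - const_poly \<gamma> - q + const_poly \<epsilon> \<in> truncated_cone h g k2"
    using perturbation_in_truncated_cone[of h "f - const_poly \<gamma> - q" g] by blast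
  have "f - const_poly \<gamma> + const_poly \<epsilon> \<in> truncated_cone h g (max k1 k2)" if "0 < \<epsilon>" for \<epsilon>
    using truncated_cone_add[OF truncated_cone_mono[OF _ k1] truncated_cone_mono[OF _ k2[OF that]], of "max k1 k2"]
    by (simp add: algebra_simps)
  then show ?thesis by blast
qed

lemma truncated_cone_nonneg_on_feasible_set:
  assumes "p \<in> truncated_cone h g k" "x \<in> feasible_set h g"
  shows "0 \<le> eval_poly p x"
proof -
  obtain a b where p: "p = a + b" "a \<in> truncated_ideal h (2 * k)" "b \<in> truncated_qmodule g k"
    using assms(1) unfolding truncated_cone_def by blast
  obtain \<phi> where a: "a = (\<Sum>i<length h. \<phi> i * h ! i)"
    using p(2) unfolding truncated_ideal_def by blast
  obtain \<sigma> where b: "b = (\<Sum>j\<le>length g. \<sigma> j * (1 # g) ! j)" "\<forall>j\<le>length g. \<sigma> j \<in> sos"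
    using p(3) unfolding truncated_qmodule_def by blast
  have "eval_poly a x = 0"
    using assms(2) by (simp add: a eval_poly_hom feasible_set_def)
  moreover have "0 \<le> eval_poly ((1 # g) ! j) x" if "j \<le> length g" for j
    using assms(2) that by (cases j) (auto simp: feasible_set_def eval_poly_hom)
  then have "0 \<le> eval_poly b x"
    using b(2) by (auto simp: b(1) eval_poly_hom eval_poly_sos intro!: sum_nonneg mult_nonneg_nonneg)
  ultimately show ?thesis by (simp add: p(1) eval_poly_hom)
qed

lemma f_relax_altdef: "f_relax f h g k = (SUP \<gamma>\<in>{\<gamma>. f - const_poly \<gamma> \<in> truncated_cone h g k}. ereal \<gamma>)"
  unfolding f_relax_def truncated_cone_def by (rule arg_cong[of _ _ "\<lambda>A. Sup (ereal ` A)"]) blast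

lemma f_relax_le_f_min: "f_relax f h g k \<le> f_min f h g"
  unfolding f_relax_altdef f_min_def
proof (intro SUP_least INF_greatest)
  fix \<gamma> x assume "\<gamma> \<in> {\<gamma>. f - const_poly \<gamma> \<in> truncated_cone h g k}" "x \<in> feasible_set h g"
  then have "0 \<le> eval_poly (f - const_poly \<gamma>) x" using truncated_cone_nonneg_on_feasible_set by blast
  then show "ereal \<gamma> \<le> ereal (eval_poly f x)" by (simp add: eval_poly_hom)
qed

lemma le_f_relax: "f - const_poly \<gamma> \<in> truncated_cone h g k \<Longrightarrow> ereal \<gamma> \<le> f_relax f h g k"
  unfolding f_relax_altdef by (rule SUP_upper) simp

theorem theorem1p1:
  fixes f :: "'n::finite rpoly" and h g :: "'n rpoly list"
  assumes "finite (real_variety h)"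
  shows "\<exists>K. \<forall>k\<ge>K. f_relax f h g k = f_min f h g"
proof (cases "feasible_set h g = {}")
  case True
  obtain k1 where "\<forall>\<epsilon>>0. f - const_poly 0 + const_poly \<epsilon> \<in> truncated_cone h g k1"
    using lower_bound_in_truncated_cone[OF assms, of g 0 f] True by auto
  then have "f - const_poly 0 + const_poly 1 \<in> truncated_cone h g k1" by (metis zero_less_one)
  then have k1: "f + const_poly 1 \<in> truncated_cone h g k1" by (simp add: const_poly_hom(4))
  \<comment> \<open>on an empty feasible set even the bound \<open>0 \<ge> 2\<close> holds\<close>
  obtain k2 where "\<forall>\<epsilon>>0. 0 - const_poly 2 + const_poly \<epsilon> \<in> truncated_cone h g k2"
    using lower_bound_in_truncated_cone[OF assms, of g 2 0] True by auto
  then have "0 - const_poly 2 + const_poly 1 \<in> truncated_cone h g k2" by (metis zero_less_one)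
  moreover have "0 - const_poly 2 + const_poly 1 = const_poly (- 1)"
    by (simp add: const_poly_1 const_poly_2 const_poly_hom(5))
  ultimately have k2: "const_poly (- 1) \<in> truncated_cone h g k2" by metis
  \<comment> \<open>with \<open>- 1\<close> certified, \<open>f - \<delta> = (f + 1) + (\<delta> + 1) (- 1)\<close> is certified in a degree independent of \<open>\<delta>\<close>\<close>
  have "f_relax f h g k = f_min f h g" if k: "k \<ge> max k1 k2" for k
  proof -
    have "ereal \<gamma> \<le> f_relax f h g k" for \<gamma>
    proof -
      define \<delta> where "\<delta> = max \<gamma> 0"
      have "f + const_poly 1 + const_poly (\<delta> + 1) * const_poly (- 1) \<in> truncated_cone h g k"
        using k by (intro truncated_cone_add truncated_cone_const_mult truncated_cone_mono[OF _ k1]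
            truncated_cone_mono[OF _ k2]) (auto simp: \<delta>_def)
      moreover have "f + const_poly 1 + const_poly (\<delta> + 1) * const_poly (- 1) = f - const_poly \<delta>"
        by (simp add: const_poly_hom(1,2,5))
      ultimately have "ereal \<delta> \<le> f_relax f h g k" by (intro le_f_relax) simp
      then show ?thesis by (rule order_trans[rotated]) (simp add: \<delta>_def)
    qed
    then have "f_relax f h g k = \<infinity>" by (intro ereal_top) auto
    moreover have "f_min f h g = \<infinity>" by (simp add: f_min_def True top_ereal_def)
    ultimately show ?thesis by simp
  qed
  then show ?thesis by blast
next
  case False
  have "feasible_set h g \<subseteq> real_variety h" by (auto simp: feasible_set_def real_variety_def)
  then have fin: "finite (feasible_set h g)" using assms finite_subset by blast
  define u where "u = arg_min_on (eval_poly f) (feasible_set h g)"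
  have u: "u \<in> feasible_set h g" "\<And>x. x \<in> feasible_set h g \<Longrightarrow> eval_poly f u \<le> eval_poly f x"
    unfolding u_def using arg_min_if_finite(1)[OF fin False] arg_min_least[OF fin False] by auto
  obtain K where K: "\<And>\<epsilon>. 0 < \<epsilon> \<Longrightarrow> f - const_poly (eval_poly f u) + const_poly \<epsilon> \<in> truncated_cone h g K"
    using lower_bound_in_truncated_cone[OF assms, of g "eval_poly f u" f] u(2) by blast
  have "f_relax f h g k = f_min f h g" if "k \<ge> K" for k
  proof (rule antisym[OF f_relax_le_f_min])
    have "f_min f h g \<le> ereal (eval_poly f u)" unfolding f_min_def by (rule INF_lower) (rule u(1))
    also have "\<dots> \<le> f_relax f h g k"
    proof (rule ereal_le_epsilon2)
      fix \<epsilon> :: real assume "0 < \<epsilon>"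
      have "f - const_poly (eval_poly f u - \<epsilon>) \<in> truncated_cone h g k"
        using truncated_cone_mono[OF that K[OF \<open>0 < \<epsilon>\<close>]] by (simp add: const_poly_hom(6) algebra_simps)
      then have "ereal (eval_poly f u - \<epsilon>) \<le> f_relax f h g k" by (rule le_f_relax)
      then show "ereal (eval_poly f u) \<le> f_relax f h g k + ereal \<epsilon>"
        by (cases "f_relax f h g k") auto
    qed
    finally show "f_min f h g \<le> f_relax f h g k" .
  qed
  then show ?thesis by blast
qed

end
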